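(* Let $m\ge2$ be even and let $q$ be an odd prime with $q\equiv1\pmod m$. (i) For every $x\in R^I_{m,q}$, $\|\rho_1(x)\|_{\infty,q}\le m\,\|x\|_{\mathrm{coef},\infty}$. (ii) Let $z\in\mu_m(\mathbb F_q)$, $z\notin\{\pm1\}$, have multiplicative order $d$. Then $\max_{0\le j<d}|[z^j]_q|\ge\sqrt{q/2}$; consequently there is $j$ such that $\|s^j\|_{\mathrm{coef},\infty}=1$ and $\|\rho_z(s^j)\|_{\infty,q}\ge\sqrt{q/2}$. (iii) Every quotient of $R^I_{m,q}$ by a two-sided ideal is the projection of $R^I_{m,q}\cong\prod_{z\in\mu_m(\mathbb F_q)/\{\pm1\}}M_2(\mathbb F_q)$ onto a subset of the blocks. If $m<\sqrt{q/2}$, then the rank-four image $\rho_1$ is maximal among quotient images whose coefficient-to-centred distortion is less than $\sqrt{q/2}$: its distortion is at most $m<\sqrt{q/2}$, whereas every quotient whose set of blocks strictly contains the block $z=1$ has distortion at least $\sqrt{q/2}$.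
   Context: $R^I_{m,q}$ is the $\mathbb F_q$-algebra generated by $s,t$ with relations $s^m=1$, $t^2=-1$, $st=-ts$, of dimension $2m$ with basis $s^i,s^it$ ($0\le i<m$). For $z\in\mu_m(\mathbb F_q)$ (the $m$-th roots of unity in $\mathbb F_q^\times$), $\rho_z:R^I_{m,q}\to M_2(\mathbb F_q)$ is the homomorphism with $\rho_z(s)=\operatorname{diag}(z,-z)$ and $\rho_z(t)=\begin{pmatrix}0&-1\\1&0\end{pmatrix}$; $\rho_z$ and $\rho_{-z}$ are conjugate, and the product of the $\rho_z$ over representatives of the pairs $\{z,-z\}$ (with $z=1$ as representative of $\{1,-1\}$) is an isomorphism onto $\prod_{z\in\mu_m(\mathbb F_q)/\{\pm1\}}M_2(\mathbb F_q)$; the factors are called blocks. $[y]_q$ is the centred integer representative of $y\in\mathbb F_q$ in $(-q/2,q/2)$. For $x=\sum_{i<m}(a_is^i+b_is^it)$, $\|x\|_{\mathrm{coef},\infty}=\max_i\{|a_i|,|b_i|\}$, with coefficients taken as centred representatives. For a matrix (or tuple of matrices) over $\mathbb F_q$, $\|\cdot\|_{\infty,q}$ is the largest absolute value of the centred representative of an entry. The coefficient-to-centred distortion of a quotient image given by a set $T$ of blocks is the supremum over $x\ne0$ of $\max_{z\in T}\|\rho_z(x)\|_{\infty,q}/\|x\|_{\mathrm{coef},\infty}$. *)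

theory Defs
  imports
    "Berlekamp_Zassenhaus.Finite_Field"
    "Jordan_Normal_Form.Matrix"
    "Jordan_Normal_Form.VS_Connect"
    "HOL-Algebra.QuotRing"
    "HOL-Algebra.Multiplicative_Group"
begin

section \<open>The algebra \<open>R\<^sup>I\<^sub>m\<close>\<close>

text \<open>
  The pair \<open>(A, B)\<close> of polynomials of degree less than \<open>m\<close> stands for \<open>A(s) + B(s) t\<close>.
  Since \<open>t C(s) = C(- s) t\<close> and \<open>t\<^sup>2 = - 1\<close>, one has
  \<open>(A + B t) (C + D t) = (A C - B D(- s)) + (A D + B C(- s)) t\<close>, reduced modulo \<open>s\<^sup>m - 1\<close>.
\<close>

definition flip :: "'k::comm_ring_1 poly \<Rightarrow> 'k poly" where
  "flip C = pcompose C [:0, -1:]"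

definition RI_modulus :: "nat \<Rightarrow> 'k::field poly" where
  "RI_modulus m = monom 1 m - 1"

definition RI :: "nat \<Rightarrow> ('k::field, 'k poly \<times> 'k poly) module" where
  "RI m =
    \<lparr> carrier = {(A, B). degree A < m \<and> degree B < m},
      monoid.mult = (\<lambda>(A, B) (C, D).
        ((A * C - B * flip D) mod RI_modulus m, (A * D + B * flip C) mod RI_modulus m)),
      one = (1, 0),
      zero = (0, 0),
      add = (\<lambda>(A, B) (C, D). (A + C, B + D)),
      module.smult = (\<lambda>c (A, B). (Polynomial.smult c A, Polynomial.smult c B)) \<rparr>"

definition RI_s :: "'k::field poly \<times> 'k poly" where
  "RI_s = (monom 1 1, 0)"

definition RI_t :: "'k::field poly \<times> 'k poly" where
  "RI_t = (0, 1)"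

text \<open>
  The linear map sending \<open>s\<^sup>i\<close> to \<open>S\<^sup>i\<close> and \<open>s\<^sup>i t\<close> to \<open>S\<^sup>i T\<close>. Theorem \<open>RI_universal\<close> below
  shows that it is the unique algebra homomorphism with \<open>s \<mapsto> S\<close>, \<open>t \<mapsto> T\<close> whenever
  \<open>S\<close> and \<open>T\<close> satisfy the defining relations, so that \<open>RI m\<close> is the algebra they present.
\<close>

definition RI_map ::
  "('k::field, 'b) module \<Rightarrow> nat \<Rightarrow> 'b \<Rightarrow> 'b \<Rightarrow> 'k poly \<times> 'k poly \<Rightarrow> 'b" where
  "RI_map A m S T x = (\<Oplus>\<^bsub>A\<^esub>i\<in>{..<m}.
     (coeff (fst x) i \<odot>\<^bsub>A\<^esub> (S [^]\<^bsub>A\<^esub> i)) \<oplus>\<^bsub>A\<^esub>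
     (coeff (snd x) i \<odot>\<^bsub>A\<^esub> ((S [^]\<^bsub>A\<^esub> i) \<otimes>\<^bsub>A\<^esub> T)))"

text \<open>The library locale \<open>algebra\<close> is restricted to commutative algebras.\<close>

locale unital_algebra = A: ring A + module "class_ring :: 'k::field ring" A
  for A :: "('k::field, 'b) module" (structure) +
  assumes smult_mult_left:
      "x \<in> carrier A \<Longrightarrow> y \<in> carrier A \<Longrightarrow> (c \<odot> x) \<otimes> y = c \<odot> (x \<otimes> y)"
    and smult_mult_right:
      "x \<in> carrier A \<Longrightarrow> y \<in> carrier A \<Longrightarrow> x \<otimes> (c \<odot> y) = c \<odot> (x \<otimes> y)"


lemma flip_simps [simp]:
  "flip 0 = 0" "flip 1 = 1" "flip (A + B) = flip A + flip B" "flip (A - B) = flip A - flip B"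
  "flip (A * B) = flip A * flip B" "flip (flip A) = A"
  "flip (Polynomial.smult c A) = Polynomial.smult c (flip A)"
  by (simp_all add: flip_def pcompose_add pcompose_diff pcompose_mult pcompose_smult
      pcompose_pCons flip: pcompose_assoc)

lemma degree_flip [simp]: "degree (flip (A :: 'k::idom poly)) = degree A"
  by (simp add: flip_def)

lemma flip_monom: "flip (monom c n) = monom (c * (- 1) ^ n) n"
proof -
  have "[:0, - 1 :: 'a:] ^ n = monom ((- 1) ^ n) n"
    by (induction n) (simp_all add: monom_Suc monom_0 minus_monom)
  then show ?thesis
    by (simp add: flip_def monom_altdef[of c] pcompose_smult pcompose_hom.hom_power
        pcompose_pCons smult_monom)
qed

lemma degree_RI_modulus: "m > 0 \<Longrightarrow> degree (RI_modulus m :: 'k::field poly) = m"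
  unfolding RI_modulus_def diff_conv_add_uminus
  by (subst degree_add_eq_left) (auto simp: degree_monom_eq)

lemma RI_modulus_nz: "m > 0 \<Longrightarrow> RI_modulus m \<noteq> (0 :: 'k::field poly)"
  using degree_RI_modulus[of m, where 'k = 'k] by auto

lemma degree_mod_RI: "m > 0 \<Longrightarrow> degree (A mod RI_modulus m :: 'k::field poly) < m"
  using degree_mod_less'[of "RI_modulus m" A] degree_RI_modulus[of m, where 'k = 'k]
    RI_modulus_nz[of m, where 'k = 'k] by (cases "A mod RI_modulus m = 0") auto

lemma mod_RI_id: "degree A < m \<Longrightarrow> (A :: 'k::field poly) mod RI_modulus m = A"
  using degree_RI_modulus[of m, where 'k = 'k] by (intro mod_poly_less) auto

lemma flip_RI_modulus: "even m \<Longrightarrow> flip (RI_modulus m) = (RI_modulus m :: 'k::field poly)"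
  by (simp add: RI_modulus_def flip_monom)

lemma flip_mod_RI:
  assumes "m > 0" "even m"
  shows "flip (A mod RI_modulus m) = flip A mod (RI_modulus m :: 'k::field poly)"
proof -
  let ?P = "RI_modulus m :: 'k poly"
  have "flip A = flip (A div ?P * ?P + A mod ?P)" by simp
  also have "\<dots> = flip (A div ?P) * ?P + flip (A mod ?P)"
    by (simp only: flip_simps flip_RI_modulus[OF assms(2)])
  finally have "flip A mod ?P = flip (A mod ?P) mod ?P" by simp
  also have "\<dots> = flip (A mod ?P)"
    by (rule mod_RI_id) (simp add: degree_mod_RI[OF assms(1)])
  finally show ?thesis by simp
qed

lemma RI_simps [simp]:
  "x \<in> carrier (RI m) \<longleftrightarrow> degree (fst x) < m \<and> degree (snd x) < m"
  "(A, B) \<otimes>\<^bsub>RI m\<^esub> (C, D) =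
     ((A * C - B * flip D) mod RI_modulus m, (A * D + B * flip C) mod RI_modulus m)"
  "\<one>\<^bsub>RI m\<^esub> = (1, 0)"
  "\<zero>\<^bsub>RI m\<^esub> = (0, 0)"
  "(A, B) \<oplus>\<^bsub>RI m\<^esub> (C, D) = (A + C, B + D)"
  "c \<odot>\<^bsub>RI m\<^esub> (A, B) = (Polynomial.smult c A, Polynomial.smult c B)"
  by (cases x; auto simp: RI_def)+

lemma mult_mod_RI:
  "(A * (B mod P)) mod P = (A * B) mod (P :: 'k::field poly)"
proof -
  have "A * (B mod P) = A * B - (A * (B div P)) * P"
    by (simp add: minus_div_mult_eq_mod[symmetric] algebra_simps)
  then show ?thesis by (simp add: poly_mod_diff_left)
qed

lemma RI_assoc:
  fixes x y w :: "'k::field poly \<times> 'k poly"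
  assumes "m > 0" "even m"
  shows "(x \<otimes>\<^bsub>RI m\<^esub> y) \<otimes>\<^bsub>RI m\<^esub> w = x \<otimes>\<^bsub>RI m\<^esub> (y \<otimes>\<^bsub>RI m\<^esub> w)"
proof -
  obtain a b c d e f where [simp]: "x = (a, b)" "y = (c, d)" "w = (e, f)"
    by (cases x; cases y; cases w) auto
  show ?thesis
    by (simp add: flip_mod_RI[OF assms] poly_mod_diff_left poly_mod_add_left mult_mod_RI
        mult.commute[of "_ mod _"]) (simp add: poly_mod_diff_left poly_mod_add_left mult_mod_RI algebra_simps)
qed

theorem RI_algebra:
  assumes "m > 0" "even m"
  shows "unital_algebra (RI m :: ('k::field, 'k poly \<times> 'k poly) module)"
proof -
  let ?R = "RI m :: ('k, 'k poly \<times> 'k poly) module"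
  have ab: "abelian_group ?R"
  proof (rule abelian_groupI)
    fix x assume "x \<in> carrier ?R"
    then show "\<exists>y\<in>carrier ?R. y \<oplus>\<^bsub>?R\<^esub> x = \<zero>\<^bsub>?R\<^esub>"
      by (intro bexI[of _ "(- fst x, - snd x)"]) (cases x, auto)
  qed (use assms in \<open>auto simp: degree_add_less\<close>)
  have mon: "Group.monoid ?R"
    using assms
    by (intro Group.monoidI RI_assoc) (auto simp: degree_mod_RI mod_RI_id)
  have "ring ?R"
    by (rule ringI[OF ab mon]) (auto simp: algebra_simps poly_mod_add_left poly_mod_diff_left)
  moreover have "Module.module (class_ring :: 'k ring) ?R"
  proof (rule moduleI)
    show "cring (class_ring :: 'k ring)"
      by unfold_locales
  qed (use ab in \<open>auto simp: smult_add_left smult_add_right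
          intro: le_less_trans[OF degree_smult_le]\<close>)
  ultimately show ?thesis
    by (intro unital_algebra.intro unital_algebra_axioms.intro)
      (auto simp: mod_smult_left[symmetric] smult_diff_right smult_add_right)
qed


theorem RI_relations:
  fixes s t :: "'k::field poly \<times> 'k poly"
  assumes "m \<ge> 2"
  defines "s \<equiv> RI_s" and "t \<equiv> RI_t"
  shows "s \<in> carrier (RI m)" "t \<in> carrier (RI m)"
    and "s [^]\<^bsub>RI m\<^esub> m = \<one>\<^bsub>RI m\<^esub>"
    and "t \<otimes>\<^bsub>RI m\<^esub> t = (- 1) \<odot>\<^bsub>RI m\<^esub> \<one>\<^bsub>RI m\<^esub>"
    and "s \<otimes>\<^bsub>RI m\<^esub> t = (- 1) \<odot>\<^bsub>RI m\<^esub> (t \<otimes>\<^bsub>RI m\<^esub> s)"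
proof -
  show "s \<in> carrier (RI m)" "t \<in> carrier (RI m)"
    using assms by (auto simp: RI_s_def RI_t_def degree_monom_eq)
  have pow: "s [^]\<^bsub>RI m\<^esub> j = (monom 1 j mod RI_modulus m, 0)" for j :: nat
  proof (induction j)
    case 0
    then show ?case using assms by (simp add: mod_RI_id nat_pow_def)
  next
    case (Suc j)
    have "(monom 1 j mod RI_modulus m * monom 1 1) mod RI_modulus m =
        (monom 1 (Suc j) :: 'k poly) mod RI_modulus m"
      by (simp add: mult.commute[of "_ mod _"] mult_mod_RI mult_monom)
    then show ?case
      using Suc assms by (simp add: nat_pow_def s_def RI_s_def)
  qed
  have "monom 1 m mod RI_modulus m = (RI_modulus m + 1) mod (RI_modulus m :: 'k poly)"
    by (simp add: RI_modulus_def)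
  also have "\<dots> = 1"
    using assms by (simp add: poly_mod_add_left mod_RI_id)
  finally show "s [^]\<^bsub>RI m\<^esub> m = \<one>\<^bsub>RI m\<^esub>" by (simp add: pow)
  show "t \<otimes>\<^bsub>RI m\<^esub> t = (- 1) \<odot>\<^bsub>RI m\<^esub> \<one>\<^bsub>RI m\<^esub>"
    using assms minus_pCons[of "1 :: 'k" 0]
    by (simp add: t_def RI_t_def mod_RI_id pCons_one)
  show "s \<otimes>\<^bsub>RI m\<^esub> t = (- 1) \<odot>\<^bsub>RI m\<^esub> (t \<otimes>\<^bsub>RI m\<^esub> s)"
    using assms
    by (simp add: s_def t_def RI_s_def RI_t_def mod_RI_id flip_monom degree_monom_eq minus_monom)
qed

context unital_algebra
begin

definition ev :: "'b \<Rightarrow> 'k poly \<Rightarrow> 'b" where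
  "ev S p = fold_coeffs (\<lambda>a r. (a \<odot> \<one>) \<oplus> (S \<otimes> r)) p \<zero>"

lemma smult_closed' [simp]: "x \<in> carrier A \<Longrightarrow> c \<odot> x \<in> carrier A"
  using smult_closed[of c x] by simp

lemma smult_l_distr': "x \<in> carrier A \<Longrightarrow> (c + d) \<odot> x = c \<odot> x \<oplus> d \<odot> x"
  using smult_l_distr[of c d x] by simp

lemma smult_r_distr':
  "x \<in> carrier A \<Longrightarrow> y \<in> carrier A \<Longrightarrow> c \<odot> (x \<oplus> y) = c \<odot> x \<oplus> c \<odot> y"
  using smult_r_distr[of c x y] by simp

lemma smult_assoc1': "x \<in> carrier A \<Longrightarrow> (c * d) \<odot> x = c \<odot> (d \<odot> x)"
  using smult_assoc1[of c d x] by simp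

lemma smult_one' [simp]: "x \<in> carrier A \<Longrightarrow> 1 \<odot> x = x"
  using smult_one[of x] by simp

lemma smult_zero' [simp]: "x \<in> carrier A \<Longrightarrow> 0 \<odot> x = \<zero>"
  using smult_l_null[of x] by simp

lemma smult_zero_right [simp]: "c \<odot> \<zero> = \<zero>"
  using smult_r_null[of c] by simp

lemma smult_minus_one: "x \<in> carrier A \<Longrightarrow> (- 1) \<odot> x = \<ominus> x"
  using smult_l_distr'[of x "- 1" 1] by (simp add: A.minus_equality)

lemma ev_0 [simp]: "ev S 0 = \<zero>"
  by (simp add: ev_def)

lemma ev_pCons:
  assumes [simp]: "S \<in> carrier A"
  shows "ev S (pCons a p) = (a \<odot> \<one>) \<oplus> (S \<otimes> ev S p)"
  by (cases "p = 0 \<and> a = 0") (auto simp: ev_def)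

lemma ev_closed [simp]: "S \<in> carrier A \<Longrightarrow> ev S p \<in> carrier A"
  by (induction p) (auto simp: ev_pCons)

lemma ev_add:
  assumes [simp]: "S \<in> carrier A"
  shows "ev S (p + q) = ev S p \<oplus> ev S q"
proof (induction p q rule: poly_induct2)
  case (pCons a p b q)
  then show ?case
    by (simp add: ev_pCons smult_l_distr' A.r_distr A.add.m_ac)
qed auto

lemma ev_smult:
  assumes [simp]: "S \<in> carrier A"
  shows "ev S (Polynomial.smult c p) = c \<odot> ev S p"
  by (induction p) (simp_all add: ev_pCons smult_r_distr' smult_assoc1' smult_mult_right)

lemma ev_mult:
  assumes [simp]: "S \<in> carrier A"
  shows "ev S (p * q) = ev S p \<otimes> ev S q"
  by (induction p)
    (simp_all add: ev_pCons ev_add ev_smult A.l_distr smult_mult_left A.m_assoc)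

lemma ev_1 [simp]: "S \<in> carrier A \<Longrightarrow> ev S 1 = \<one>"
  by (simp add: one_pCons ev_pCons)

lemma ev_minus: "S \<in> carrier A \<Longrightarrow> ev S (- p) = \<ominus> ev S p"
  using ev_smult[of S "- 1" p] by (simp add: smult_minus_one)

lemma ev_diff: "S \<in> carrier A \<Longrightarrow> ev S (p - q) = ev S p \<ominus> ev S q"
  using ev_add[of S p "- q"] by (simp add: a_minus_def ev_minus)

lemma ev_monom:
  assumes [simp]: "S \<in> carrier A"
  shows "ev S (monom c n) = c \<odot> (S [^] n)"
proof (induction n)
  case (Suc n)
  then show ?case
    by (simp add: monom_Suc ev_pCons smult_mult_right A.nat_pow_comm[of S 1 n, simplified])
qed (simp add: monom_0 ev_pCons)

lemma ev_sum:
  assumes [simp]: "S \<in> carrier A"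
  shows "ev S (\<Sum>i<n. monom (c i) i) = (\<Oplus>i\<in>{..<n}. c i \<odot> (S [^] i))"
proof (induction n)
  case (Suc n)
  then show ?case
    by (simp add: lessThan_Suc ev_add ev_monom Pi_def A.add.m_comm)
qed simp

lemma ev_eq:
  assumes "S \<in> carrier A" "degree p < n"
  shows "ev S p = (\<Oplus>i\<in>{..<n}. coeff p i \<odot> (S [^] i))"
proof -
  have "(\<Sum>i<n. monom (coeff p i) i) = p"
    using poly_as_sum_of_monoms'[of p "n - 1"] assms
    by (cases n) (simp_all add: lessThan_Suc_atMost)
  then show ?thesis
    using ev_sum[OF assms(1), of "coeff p" n] by simp
qed

lemma RI_map_eq:
  assumes [simp]: "S \<in> carrier A" "T \<in> carrier A" and x: "x \<in> carrier (RI m)"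
  shows "RI_map A m S T x = ev S (fst x) \<oplus> (ev S (snd x) \<otimes> T)"
  using x
  by (simp add: RI_map_def A.finsum_addf Pi_def ev_eq[of _ _ m] A.finsum_ldistr smult_mult_left)

end

lemma RI_ev:
  assumes "m \<ge> 2" "even m"
  shows "unital_algebra.ev (RI m) RI_s p = (p mod RI_modulus m, 0 :: 'k::field poly)"
proof -
  interpret unital_algebra "RI m :: ('k, 'k poly \<times> 'k poly) module"
    using assms by (intro RI_algebra) auto
  have s: "RI_s \<in> carrier (RI m)"
    by (rule RI_relations[OF assms(1)])
  show ?thesis
  proof (induction p)
    case (pCons a p)
    have "pCons a p = [:a:] + monom 1 1 * p"
      by (simp add: monom_Suc monom_0)
    then have "pCons a p mod RI_modulus m =
        [:a:] + (monom 1 1 * (p mod RI_modulus m)) mod RI_modulus m"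
      using assms by (simp only: poly_mod_add_left mult_mod_RI) (simp add: mod_RI_id)
    then show ?case
      using pCons by (subst ev_pCons[OF s]) (simp add: RI_s_def)
  qed simp
qed

text \<open>The elements \<open>s\<^sup>i\<close>, \<open>s\<^sup>i t\<close> form a basis, with coordinates the coefficients of \<open>A\<close> and \<open>B\<close>.\<close>

theorem RI_basis:
  fixes x :: "'k::field poly \<times> 'k poly"
  assumes "m \<ge> 2" "even m" "x \<in> carrier (RI m)"
  shows "RI_map (RI m) m RI_s RI_t x = x"
proof -
  interpret unital_algebra "RI m :: ('k, 'k poly \<times> 'k poly) module"
    using assms by (intro RI_algebra) auto
  show ?thesis
    using RI_relations(1,2)[OF assms(1), where 'k = 'k] assms
    by (cases x) (simp add: RI_map_eq RI_ev mod_RI_id, simp add: RI_t_def mod_RI_id)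
qed

theorem RI_universal:
  fixes A :: "('k::field, 'b) module" (structure)
  assumes "unital_algebra A" and m: "m \<ge> 2" "even m"
    and [simp]: "S \<in> carrier A" "T \<in> carrier A"
    and rel: "S [^] m = \<one>" "T \<otimes> T = \<ominus> \<one>" "S \<otimes> T = \<ominus> (T \<otimes> S)"
  shows "RI_map A m S T \<in> Ring.ring_hom (RI m) A"
    and "\<And>c x. x \<in> carrier (RI m) \<Longrightarrow> RI_map A m S T (c \<odot>\<^bsub>RI m\<^esub> x) = c \<odot> RI_map A m S T x"
    and "RI_map A m S T RI_s = S" "RI_map A m S T RI_t = T"
    and "\<And>f x. \<lbrakk> f \<in> Ring.ring_hom (RI m) A;
          \<And>c x. x \<in> carrier (RI m) \<Longrightarrow> f (c \<odot>\<^bsub>RI m\<^esub> x) = c \<odot> f x;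
          f RI_s = S; f RI_t = T; x \<in> carrier (RI m) \<rbrakk> \<Longrightarrow> f x = RI_map A m S T x"
proof -
  interpret unital_algebra A by fact
  interpret R: unital_algebra "RI m :: ('k, 'k poly \<times> 'k poly) module"
    using m by (intro RI_algebra) auto
  let ?f = "RI_map A m S T"
  note st = RI_relations[OF m(1), where 'k = 'k]
  have ev_mod: "ev S (p mod RI_modulus m) = ev S p" for p
  proof -
    have "ev S (RI_modulus m) = \<zero>"
      by (simp add: RI_modulus_def ev_diff ev_monom rel(1) A.r_neg a_minus_def)
    then have "ev S (p div RI_modulus m * RI_modulus m + p mod RI_modulus m) =
        ev S (p mod RI_modulus m)"
      by (simp only: ev_add[OF assms(4)] ev_mult[OF assms(4)]) simp
    then show ?thesis by simp
  qed
  have TS: "T \<otimes> S = \<ominus> (S \<otimes> T)"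
    by (simp add: rel(3))
  have ev_flip: "T \<otimes> ev S p = ev S (flip p) \<otimes> T" for p
  proof (induction p)
    case (pCons a p)
    have fl: "flip (pCons a p) = pCons a (- flip p)"
      by (simp add: flip_def pcompose_pCons)
    have "T \<otimes> (S \<otimes> ev S p) = \<ominus> (S \<otimes> (T \<otimes> ev S p))"
      by (simp add: A.m_assoc[symmetric] TS A.l_minus)
    then show ?case
      by (simp add: fl ev_pCons A.r_distr A.l_distr smult_mult_left smult_mult_right ev_minus
          A.r_minus A.l_minus pCons A.m_assoc)
  qed simp
  have fx: "?f (a, b) = ev S a \<oplus> (ev S b \<otimes> T)" if "(a, b) \<in> carrier (RI m)" for a b
    using RI_map_eq[OF _ _ that] by simp
  have s1: "(ev S b \<otimes> T) \<otimes> ev S c = ev S (b * flip c) \<otimes> T" for b c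
    by (simp add: A.m_assoc ev_flip ev_mult)
  have s2: "(ev S b \<otimes> T) \<otimes> (ev S d \<otimes> T) = \<ominus> ev S (b * flip d)" for b d
    by (simp add: A.m_assoc[symmetric] s1)
      (simp add: A.m_assoc rel(2) A.r_minus)
  show "?f \<in> Ring.ring_hom (RI m) A"
  proof (rule ring_hom_memI)
    fix x :: "'k poly \<times> 'k poly" assume "x \<in> carrier (RI m)"
    then show "?f x \<in> carrier A" by (simp add: RI_map_eq)
  next
    fix x y :: "'k poly \<times> 'k poly" assume xy: "x \<in> carrier (RI m)" "y \<in> carrier (RI m)"
    obtain a b c d where [simp]: "x = (a, b)" "y = (c, d)" by (cases x; cases y) auto
    have "x \<otimes>\<^bsub>RI m\<^esub> y \<in> carrier (RI m)" using xy by (rule R.A.m_closed)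
    then have "?f (x \<otimes>\<^bsub>RI m\<^esub> y) =
        (ev S (a * c) \<ominus> ev S (b * flip d)) \<oplus> ((ev S (a * d) \<oplus> ev S (b * flip c)) \<otimes> T)"
      by (simp add: fx ev_mod ev_diff ev_add)
    also have "\<dots> = (ev S a \<oplus> (ev S b \<otimes> T)) \<otimes> (ev S c \<oplus> (ev S d \<otimes> T))"
      by (simp add: A.l_distr A.r_distr s1 s2 a_minus_def ev_mult A.m_assoc A.add.m_ac)
    finally show "?f (x \<otimes>\<^bsub>RI m\<^esub> y) = ?f x \<otimes> ?f y"
      using xy by (simp add: fx)
    have "x \<oplus>\<^bsub>RI m\<^esub> y \<in> carrier (RI m)" using xy by (rule R.A.a_closed)
    then show "?f (x \<oplus>\<^bsub>RI m\<^esub> y) = ?f x \<oplus> ?f y"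
      using xy by (simp add: fx ev_add A.l_distr A.add.m_ac)
  next
    show "?f \<one>\<^bsub>RI m\<^esub> = \<one>" using m by (simp add: fx)
  qed
  show "?f (c \<odot>\<^bsub>RI m\<^esub> x) = c \<odot> ?f x" if x: "x \<in> carrier (RI m)" for c and x :: "'k poly \<times> 'k poly"
  proof -
    obtain a b where [simp]: "x = (a, b)" by (cases x) auto
    have "c \<odot>\<^bsub>RI m\<^esub> x \<in> carrier (RI m)" using x by (rule R.smult_closed')
    then show ?thesis
      using x by (simp add: fx ev_smult smult_r_distr' smult_mult_left)
  qed
  show "?f RI_s = S"
    using st(1) by (simp add: RI_s_def fx ev_monom)
  show "?f RI_t = T"
    using st(2) by (simp add: RI_t_def fx)
  fix f and x :: "'k poly \<times> 'k poly"
  assume f: "f \<in> Ring.ring_hom (RI m) A"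
    and lin: "\<And>c x. x \<in> carrier (RI m) \<Longrightarrow> f (c \<odot>\<^bsub>RI m\<^esub> x) = c \<odot> f x"
    and fs: "f RI_s = S" and ft: "f RI_t = T" and x: "x \<in> carrier (RI m)"
  note hom = ring_hom_memE[OF f]
  have f0: "f \<zero>\<^bsub>RI m\<^esub> = \<zero>"
    using lin[of "\<zero>\<^bsub>RI m\<^esub>" 0] hom(1)[of "\<zero>\<^bsub>RI m\<^esub>"] R.A.zero_closed
    by (simp del: RI_simps)
  have f_ev: "f (R.ev RI_s p) = ev S p" for p
  proof (induction p)
    case 0
    then show ?case using f0 by (simp del: RI_simps)
  next
    case (pCons a p)
    then show ?case
      using st(1)
      by (simp add: ev_pCons R.ev_pCons[OF st(1)] hom lin fs del: RI_simps)
  qed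
  have "x = RI_map (RI m) m RI_s RI_t x"
    using RI_basis[OF m x] by simp
  also have "\<dots> = R.ev RI_s (fst x) \<oplus>\<^bsub>RI m\<^esub> (R.ev RI_s (snd x) \<otimes>\<^bsub>RI m\<^esub> RI_t)"
    by (rule R.RI_map_eq[OF st(1,2) x])
  finally have "f x = f (R.ev RI_s (fst x) \<oplus>\<^bsub>RI m\<^esub> (R.ev RI_s (snd x) \<otimes>\<^bsub>RI m\<^esub> RI_t))"
    by simp
  also have "\<dots> = ev S (fst x) \<oplus> (ev S (snd x) \<otimes> T)"
    using st(1,2) by (simp add: hom f_ev ft del: RI_simps)
  finally show "f x = ?f x"
    using x by (simp add: RI_map_eq)
qed


section \<open>Blocks\<close>

abbreviation M2 :: "('k::field, 'k mat) module" where
  "M2 \<equiv> module_mat TYPE('k) 2 2"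

definition rho :: "nat \<Rightarrow> 'k::field \<Rightarrow> 'k poly \<times> 'k poly \<Rightarrow> 'k mat" where
  "rho m z = RI_map M2 m
     (mat_of_rows_list 2 [[z, 0], [0, - z]])
     (mat_of_rows_list 2 [[0, -1], [1, 0]])"

definition mu :: "nat \<Rightarrow> 'k::field set" where
  "mu m = {z. z ^ m = 1}"

lemma M2_algebra: "unital_algebra (M2 :: ('k::field, 'k mat) module)"
proof (intro unital_algebra.intro unital_algebra_axioms.intro moduleI)
  show "ring (M2 :: ('k, 'k mat) module)"
    by (unfold_locales, insert add_inv_exists_mat, auto simp: module_mat_def Units_def algebra_simps)
  show "cring (class_ring :: 'k ring)" by unfold_locales
  show "abelian_group (M2 :: ('k, 'k mat) module)" by (rule abelian_group_mat)
qed (auto simp: module_mat_simps mult_smult_assoc_mat[of _ 2 2 _ 2] mult_smult_distrib[of _ 2 2 _ 2]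
    algebra_simps intro!: eq_matI)

theorem rho_hom:
  fixes z :: "'k::field"
  assumes "m \<ge> 2" "even m" "z \<in> mu m"
  shows "rho m z \<in> Ring.ring_hom (RI m) M2"
    and "\<And>c x. x \<in> carrier (RI m) \<Longrightarrow> rho m z (c \<odot>\<^bsub>RI m\<^esub> x) = c \<cdot>\<^sub>m rho m z x"
    and "rho m z RI_s = mat_of_rows_list 2 [[z, 0], [0, - z]]"
    and "rho m z RI_t = mat_of_rows_list 2 [[0, -1], [1, 0]]"
proof -
  interpret unital_algebra "M2 :: ('k, 'k mat) module" by (rule M2_algebra)
  let ?S = "mat_of_rows_list 2 [[z, 0], [0, - z]]"
  let ?T = "mat_of_rows_list 2 [[0, -1], [1, 0]] :: 'k mat"
  have le2: "i < Suc (Suc 0) \<longleftrightarrow> i = 0 \<or> i = Suc 0" for i :: nat by auto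
  have c: "?S \<in> carrier M2" "?T \<in> carrier M2"
    by (auto simp: module_mat_simps mat_of_rows_list_def)
  have neg: "\<ominus>\<^bsub>M2\<^esub> X = (- 1) \<cdot>\<^sub>m X" if "X \<in> carrier M2" for X :: "'k mat"
    using smult_minus_one[OF that] by (simp add: module_mat_simps)
  have pow: "?S [^]\<^bsub>M2\<^esub> j = mat_of_rows_list 2 [[z ^ j, 0], [0, (- z) ^ j]]" for j :: nat
    by (induction j)
      (auto simp: nat_pow_def module_mat_simps mat_of_rows_list_def scalar_prod_def le2
        numeral_2_eq_2 intro!: eq_matI)
  have r1: "?S [^]\<^bsub>M2\<^esub> m = \<one>\<^bsub>M2\<^esub>"
    unfolding pow using assms
    by (auto simp: mu_def module_mat_simps mat_of_rows_list_def le2 numeral_2_eq_2 intro!: eq_matI)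
  have r2: "?T \<otimes>\<^bsub>M2\<^esub> ?T = \<ominus>\<^bsub>M2\<^esub> \<one>\<^bsub>M2\<^esub>"
    by (subst neg)
      (auto simp: module_mat_simps mat_of_rows_list_def le2 scalar_prod_def numeral_2_eq_2
        intro!: eq_matI)
  have r3: "?S \<otimes>\<^bsub>M2\<^esub> ?T = \<ominus>\<^bsub>M2\<^esub> (?T \<otimes>\<^bsub>M2\<^esub> ?S)"
    by (subst neg[OF A.m_closed[OF c(2,1)]])
      (auto simp: module_mat_simps mat_of_rows_list_def le2 scalar_prod_def numeral_2_eq_2
        intro!: eq_matI)
  note U = RI_universal[OF M2_algebra assms(1,2) c r1 r2 r3, folded rho_def]
  show "rho m z \<in> Ring.ring_hom (RI m) M2"
    "rho m z RI_s = mat_of_rows_list 2 [[z, 0], [0, - z]]"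
    "rho m z RI_t = mat_of_rows_list 2 [[0, -1], [1, 0]]"
    by (rule U)+
  show "rho m z (c \<odot>\<^bsub>RI m\<^esub> x) = c \<cdot>\<^sub>m rho m z x" if "x \<in> carrier (RI m)" for c x
    using U(2)[OF that] by (simp add: module_mat_simps)
qed

text \<open>
  A system of representatives of the pairs \<open>{z, - z}\<close> with \<open>1\<close> representing \<open>{1, - 1}\<close>. As
  \<open>\<rho>\<^sub>z\<close> and \<open>\<rho>\<^sub>-\<^sub>z\<close> have the same entries up to order and sign, norms do not depend on it.
\<close>

definition block_reps :: "nat \<Rightarrow> 'k::field set \<Rightarrow> bool" where
  "block_reps m Z \<longleftrightarrow> Z \<subseteq> mu m \<and> 1 \<in> Z \<and> (\<forall>z\<in>mu m. z \<in> Z \<longleftrightarrow> - z \<notin> Z)"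

definition block_ring :: "'k::field set \<Rightarrow> ('k \<Rightarrow> 'k mat) ring" where
  "block_ring T =
    \<lparr> carrier = T \<rightarrow>\<^sub>E carrier M2,
      monoid.mult = (\<lambda>f g. \<lambda>z\<in>T. f z \<otimes>\<^bsub>M2\<^esub> g z),
      one = (\<lambda>z\<in>T. \<one>\<^bsub>M2\<^esub>),
      zero = (\<lambda>z\<in>T. \<zero>\<^bsub>M2\<^esub>),
      add = (\<lambda>f g. \<lambda>z\<in>T. f z \<oplus>\<^bsub>M2\<^esub> g z) \<rparr>"

definition block_proj ::
  "nat \<Rightarrow> 'k::field set \<Rightarrow> 'k poly \<times> 'k poly \<Rightarrow> 'k \<Rightarrow> 'k mat" where
  "block_proj m T x = (\<lambda>z\<in>T. rho m z x)"


section \<open>Norms and distortion\<close>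

definition centred :: "'p::prime_card mod_ring \<Rightarrow> int" where
  "centred y = (THE n. of_int n = y \<and> 2 * \<bar>n\<bar> < int CARD('p))"

lemma centred:
  fixes y :: "'p::prime_card mod_ring"
  assumes "odd CARD('p)"
  shows "of_int (centred y) = y" "2 * \<bar>centred y\<bar> < int CARD('p)"
proof -
  let ?q = "int CARD('p)" and ?k = "to_int_mod_ring y"
  have eq: "of_int a = (of_int b :: 'p mod_ring) \<longleftrightarrow> ?q dvd a - b" for a b
    by (simp add: of_int_of_int_mod_ring of_int_mod_ring.abs_eq Abs_mod_ring_inject
        mod_eq_dvd_iff)
  have k: "of_int ?k = y" "0 \<le> ?k" "?k < ?q"
    using range_to_int_mod_ring[where 'a = 'p]
    by (auto simp: of_int_of_int_mod_ring set_eq_iff)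
  have "\<exists>!n. of_int n = y \<and> 2 * \<bar>n\<bar> < ?q"
  proof (rule ex_ex1I)
    have "2 * ?k \<noteq> ?q" using assms by (metis dvd_triv_left even_of_nat_iff)
    then show "\<exists>n. of_int n = y \<and> 2 * \<bar>n\<bar> < ?q"
      using k eq[of "?k - ?q" ?k]
      by (cases "2 * ?k < ?q") (auto intro: exI[of _ ?k] exI[of _ "?k - ?q"])
  next
    fix a b assume ab: "of_int a = y \<and> 2 * \<bar>a\<bar> < ?q" "of_int b = y \<and> 2 * \<bar>b\<bar> < ?q"
    then have "?q dvd a - b" using eq[of a b] by metis
    moreover have "\<bar>a - b\<bar> < ?q" using ab by linarith
    ultimately show "a = b" using dvd_imp_le_int[of "a - b" ?q] by (cases "a = b") auto
  qed
  from theI'[OF this] show "of_int (centred y) = y" "2 * \<bar>centred y\<bar> < ?q"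
    unfolding centred_def by auto
qed

definition coef_norm ::
  "nat \<Rightarrow> 'p::prime_card mod_ring poly \<times> 'p mod_ring poly \<Rightarrow> int" where
  "coef_norm m x =
     Max ((\<lambda>i. max \<bar>centred (coeff (fst x) i)\<bar> \<bar>centred (coeff (snd x) i)\<bar>) ` {..<m})"

definition mat_norm :: "'p::prime_card mod_ring mat \<Rightarrow> int" where
  "mat_norm M = Max ((\<lambda>y. \<bar>centred y\<bar>) ` elements_mat M)"

text \<open>Inserting \<open>0\<close> only matters for the empty tuple, which thereby has norm \<open>0\<close>.\<close>

definition tuple_norm ::
  "'p::prime_card mod_ring set \<Rightarrow> ('p mod_ring \<Rightarrow> 'p mod_ring mat) \<Rightarrow> int" where
  "tuple_norm T f = Max (insert 0 ((\<lambda>z. mat_norm (f z)) ` T))"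

definition distortion :: "nat \<Rightarrow> 'p::prime_card mod_ring set \<Rightarrow> real" where
  "distortion m T =
     (SUP x \<in> carrier (RI m) - {\<zero>\<^bsub>RI m\<^esub>}.
        real_of_int (tuple_norm T (block_proj m T x)) / real_of_int (coef_norm m x))"

end

theory Submission
  imports Defs
begin

text \<open>
  Explicitly, \<open>\<rho>\<^sub>z(A + B t)\<close> has rows \<open>(A(z), - B(z))\<close> and \<open>(B(- z), A(- z))\<close>. Since
  \<open>q \<equiv> 1\<close> modulo \<open>m\<close>, there are exactly \<open>m\<close> roots of unity, so that interpolation in degree less
  than \<open>m\<close> yields the block decomposition; each block is simple, hence an ideal is determined
  by the blocks on which it vanishes. At \<open>z = 1\<close> the entries are signed sums of \<open>m\<close> coefficients,
  which bounds the distortion by \<open>m\<close>. For \<open>z \<noteq> \<plusminus>1\<close> the lifts of \<open>z\<close> and \<open>z\<^sup>-\<^sup>1\<close> cannot both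
  be small, because their product is \<open>1\<close> modulo \<open>q\<close> but not in the integers; the basis
  elements \<open>s\<^sup>j\<close> then force a large distortion.
\<close>

section \<open>Roots of unity and interpolation\<close>

text \<open>The group \<open>units_of class_ring\<close> carries \<open>group.ord\<close> and
  Lagrange's theorem. This fact and the next two carry them over to ordinary field
  arithmetic.\<close>

lemma pow_units_class_ring:
  "x [^]\<^bsub>units_of (class_ring :: 'k::field ring)\<^esub> (n :: nat) = x ^ n"
  by (induction n) (simp_all add: nat_pow_def units_of_def mult.commute)

lemma carrier_units_class_ring:
  "carrier (units_of (class_ring :: 'k::field ring)) = UNIV - {0}"
proof -
  have "\<exists>y. y * x = 1 \<and> x * y = 1" if "x \<noteq> 0" for x :: 'k
    using that by (intro exI[of _ "inverse x"]) simp
  then show ?thesis by (auto simp: units_of_def Units_def)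
qed

lemma group_units_class_ring: "group (units_of (class_ring :: 'k::field ring))"
  by (rule monoid.units_group) (unfold_locales, auto)

text \<open>Lagrange's theorem in the unit group, whose order is
  \<open>CARD('k) - 1\<close>.\<close>

lemma power_card_minus_1:
  fixes x :: "'k::{field, finite}"
  assumes "x \<noteq> 0"
  shows "x ^ (CARD('k) - 1) = 1"
  using group.pow_order_eq_1[OF group_units_class_ring, of x] assms
  by (simp add: carrier_units_class_ring pow_units_class_ring Coset.order_def units_of_one
      card_Diff_singleton)

lemma mu_iff_root: "z \<in> mu m \<longleftrightarrow> poly (RI_modulus m) z = 0"
  by (simp add: mu_def RI_modulus_def poly_monom)

lemma uminus_mu: "even m \<Longrightarrow> - z \<in> mu m \<longleftrightarrow> z \<in> mu m"
  by (simp add: mu_def)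

text \<open>
  With \<open>n = |k| - 1 = m l\<close>, the polynomial \<open>x\<^sup>n - 1\<close> has \<open>n\<close> roots and factors as \<open>x\<^sup>m - 1\<close>
  times a polynomial of degree at most \<open>n - m\<close>.
\<close>

lemma card_mu:
  assumes "m > 0" "m dvd CARD('k) - 1"
  shows "card (mu m :: 'k::{field, finite} set) = m"
proof (rule antisym)
  have mu: "(mu m :: 'k set) = {z. poly (RI_modulus m) z = 0}"
    by (auto simp: mu_iff_root)
  show "card (mu m :: 'k set) \<le> m"
    using card_poly_roots_bound[OF RI_modulus_nz[OF assms(1)]] degree_RI_modulus[OF assms(1)]
    unfolding mu by metis
  obtain l where l: "CARD('k) - 1 = m * l" using assms(2) by blast
  \<comment> \<open>The distinct elements 0 and 1 force \<open>l > 0\<close>; otherwise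
    \<open>g\<close> would be the empty sum.\<close>
  have "CARD('k) > 1"
    using card_mono[of UNIV "{0, 1 :: 'k}"] by simp
  then have "l > 0" using l by (cases l) auto
  define g :: "'k poly" where "g = (\<Sum>i<l. monom 1 (m * i))"
  \<comment> \<open>Only \<open>i = 0\<close> contributes, since \<open>m > 0\<close>. This gives
    \<open>g \<noteq> 0\<close>, as the bound on the number of roots requires.\<close>
  have g0: "coeff g 0 = 1"
    using \<open>l > 0\<close> assms(1)
    by (simp add: g_def coeff_sum coeff_monom sum.delta)
  then have "g \<noteq> 0" by auto
  have "degree g \<le> m * (l - 1)"
    unfolding g_def
    by (rule degree_sum_le) (use assms(1) in \<open>auto simp: degree_monom_eq\<close>)
  have "UNIV - {0} \<subseteq> (mu m :: 'k set) \<union> {z. poly g z = 0}"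
  proof
    fix z :: 'k assume "z \<in> UNIV - {0}"
    then have "z ^ (m * l) = 1" using power_card_minus_1[of z] l by simp
    \<comment> \<open>Geometric sum in \<open>z ^ m\<close>: since the right-hand side is 0, one of
      the two factors vanishes.\<close>
    moreover have "poly g z * (z ^ m - 1) = z ^ (m * l) - 1"
      using power_diff_1_eq[of "z ^ m" l]
      by (simp add: g_def poly_sum poly_monom power_mult mult.commute[of _ "z ^ m - 1"])
    ultimately show "z \<in> mu m \<union> {z. poly g z = 0}" by (auto simp: mu_def)
  qed
  then have "CARD('k) - 1 \<le> card (mu m :: 'k set) + card {z. poly g z = 0}"
    using card_mono[of "mu m \<union> {z. poly g z = 0}" "UNIV - {0}"]
      card_Un_le[of "mu m" "{z. poly g z = 0}"] by (simp add: card_Diff_singleton)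
  moreover have "card {z. poly g z = 0} \<le> m * (l - 1)"
    using card_poly_roots_bound[OF \<open>g \<noteq> 0\<close>] \<open>degree g \<le> _\<close> by linarith
  ultimately show "m \<le> card (mu m :: 'k set)"
    using l \<open>l > 0\<close> by (cases l) auto
qed

text \<open>Newton's scheme: adding a multiple of \<open>v\<close>, which vanishes at the old nodes
  and not at \<open>a\<close>, corrects the value at \<open>a\<close> alone.\<close>

lemma poly_interpolation:
  fixes f :: "'k::field \<Rightarrow> 'k"
  assumes "finite S"
  shows "\<exists>p. degree p \<le> card S - 1 \<and> (\<forall>x\<in>S. poly p x = f x)"
  using assms
proof (induction S)
  case (insert a S)
  then obtain p where p: "degree p \<le> card S - 1" "\<forall>x\<in>S. poly p x = f x" by blast
  define v where "v = (\<Prod>x\<in>S. [:- x, 1:])"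
  have v: "poly v x = 0" if "x \<in> S" for x
    using that insert.hyps by (auto simp: v_def poly_prod)
  have va: "poly v a \<noteq> 0"
    using insert.hyps by (auto simp: v_def poly_prod)
  have "degree v \<le> (\<Sum>x\<in>S. degree [:- x, 1:])"
    unfolding v_def using degree_prod_sum_le[OF insert.hyps(1), of "\<lambda>x. [:- x, 1:]"] by (simp add: o_def)
  then have "degree v \<le> card S" by simp
  then have "degree (p + Polynomial.smult ((f a - poly p a) / poly v a) v) \<le> card S"
    using p(1) by (intro degree_add_le order_trans[OF degree_smult_le]) auto
  then show ?case
    using insert.hyps p(2) v va
    by (intro exI[of _ "p + Polynomial.smult ((f a - poly p a) / poly v a) v"]) auto
qed (auto intro: exI[of _ 0])


section \<open>The block decomposition\<close>

lemma less_2_iff: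
  fixes i :: nat
  shows "i < 2 \<longleftrightarrow> i = 0 \<or> i = Suc 0" "i < Suc (Suc 0) \<longleftrightarrow> i = 0 \<or> i = Suc 0"
  by auto

lemma M2_eqI:
  assumes "M \<in> carrier M2" "N \<in> carrier M2"
    and "M $$ (0, 0) = N $$ (0, 0)" "M $$ (0, 1) = N $$ (0, 1)"
      "M $$ (1, 0) = N $$ (1, 0)" "M $$ (1, 1) = N $$ (1, 1)"
  shows "M = N"
  using assms by (intro eq_matI) (auto simp: module_mat_simps less_2_iff)

text \<open>A polynomial in a diagonal matrix acts on each diagonal entry separately, and right
  multiplication by the image of t moves the second summand off the diagonal.\<close>

lemma rho_eq:
  fixes z :: "'k::field"
  assumes "x \<in> carrier (RI m)"
  shows "rho m z x = mat_of_rows_list 2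
    [[poly (fst x) z, - poly (snd x) z], [poly (snd x) (- z), poly (fst x) (- z)]]"
proof -
  interpret unital_algebra "M2 :: ('k, 'k mat) module" by (rule M2_algebra)
  let ?S = "mat_of_rows_list 2 [[z, 0], [0, - z]]"
  let ?T = "mat_of_rows_list 2 [[0, -1], [1, 0]] :: 'k mat"
  have c: "?S \<in> carrier M2" "?T \<in> carrier M2"
    by (auto simp: module_mat_simps mat_of_rows_list_def)
  have ev: "ev ?S p = mat_of_rows_list 2 [[poly p z, 0], [0, poly p (- z)]]" for p
  proof (induction p)
    case 0
    show ?case
      by (auto simp: module_mat_simps mat_of_rows_list_def less_2_iff intro!: eq_matI)
  next
    case (pCons a p)
    show ?case
      unfolding ev_pCons[OF c(1)] pCons.IH
      by (auto simp: module_mat_simps mat_of_rows_list_def less_2_iff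
          scalar_prod_def numeral_2_eq_2 intro!: eq_matI)
  qed
  show ?thesis
    unfolding rho_def RI_map_eq[OF c assms] ev
    by (auto simp: module_mat_simps mat_of_rows_list_def less_2_iff
          scalar_prod_def numeral_2_eq_2 intro!: eq_matI)
qed

lemma rho_index:
  fixes z :: "'k::field"
  assumes "x \<in> carrier (RI m)"
  shows "rho m z x \<in> carrier M2"
    and "rho m z x $$ (0, 0) = poly (fst x) z" "rho m z x $$ (0, 1) = - poly (snd x) z"
    and "rho m z x $$ (1, 0) = poly (snd x) (- z)" "rho m z x $$ (1, 1) = poly (fst x) (- z)"
  by (auto simp: rho_eq[OF assms] module_mat_simps mat_of_rows_list_def)

section \<open>The product ring of the blocks\<close>

lemma block_ring_simps [simp]:
  "carrier (block_ring T) = T \<rightarrow>\<^sub>E carrier M2"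
  "f \<otimes>\<^bsub>block_ring T\<^esub> g = (\<lambda>z\<in>T. f z \<otimes>\<^bsub>M2\<^esub> g z)"
  "\<one>\<^bsub>block_ring T\<^esub> = (\<lambda>z\<in>T. \<one>\<^bsub>M2\<^esub>)"
  "\<zero>\<^bsub>block_ring T\<^esub> = (\<lambda>z\<in>T. \<zero>\<^bsub>M2\<^esub>)"
  "f \<oplus>\<^bsub>block_ring T\<^esub> g = (\<lambda>z\<in>T. f z \<oplus>\<^bsub>M2\<^esub> g z)"
  by (simp_all add: block_ring_def)

lemma ring_block_ring: "ring (block_ring (T :: 'k::field set))"
proof -
  interpret M: ring "M2 :: ('k, 'k mat) module"
    using M2_algebra by (rule unital_algebra.axioms)
  have mem: "f z \<in> carrier M2" if "f \<in> T \<rightarrow>\<^sub>E carrier M2" "z \<in> T" for f z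
    using that by auto
  have ext: "(\<lambda>z\<in>T. g z) = f" if "f \<in> T \<rightarrow>\<^sub>E carrier M2" "\<And>z. z \<in> T \<Longrightarrow> g z = f z" for f g
    using that by (auto simp: fun_eq_iff PiE_iff extensional_def)
  have "abelian_group (block_ring T)"
  proof (rule abelian_groupI)
    fix f assume f: "f \<in> carrier (block_ring T)"
    show "\<exists>g\<in>carrier (block_ring T). g \<oplus>\<^bsub>block_ring T\<^esub> f = \<zero>\<^bsub>block_ring T\<^esub>"
      by (rule bexI[of _ "\<lambda>z\<in>T. \<ominus>\<^bsub>M2\<^esub> f z"])
        (use f in \<open>auto simp: M.l_neg mem intro!: restrict_ext\<close>)
  qed (auto simp: mem M.add.m_ac intro!: ext restrict_ext)
  moreover have "Group.monoid (block_ring T)"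
    by (rule Group.monoidI) (auto simp: mem M.m_assoc intro!: ext restrict_ext)
  ultimately show ?thesis
    by (rule ringI) (auto simp: mem M.l_distr M.r_distr intro!: restrict_ext)
qed

lemma block_proj_hom:
  fixes T :: "'k::field set"
  assumes "m \<ge> 2" "even m" "T \<subseteq> mu m"
  shows "block_proj m T \<in> Ring.ring_hom (RI m) (block_ring T)"
proof (rule ring_hom_memI)
  note hom = ring_hom_memE[OF rho_hom(1)[OF assms(1,2)]]
  have mu: "z \<in> mu m" if "z \<in> T" for z using that assms(3) by blast
  show "block_proj m T x \<in> carrier (block_ring T)" if "x \<in> carrier (RI m)" for x
    using hom(1)[OF mu that] by (auto simp: block_proj_def)
  fix x y :: "'k poly \<times> 'k poly" assume xy: "x \<in> carrier (RI m)" "y \<in> carrier (RI m)"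
  show "block_proj m T (x \<otimes>\<^bsub>RI m\<^esub> y) =
      block_proj m T x \<otimes>\<^bsub>block_ring T\<^esub> block_proj m T y"
    by (auto simp: block_proj_def hom(2)[OF mu xy] intro!: restrict_ext simp del: RI_simps)
  show "block_proj m T (x \<oplus>\<^bsub>RI m\<^esub> y) =
      block_proj m T x \<oplus>\<^bsub>block_ring T\<^esub> block_proj m T y"
    by (auto simp: block_proj_def hom(3)[OF mu xy] intro!: restrict_ext simp del: RI_simps)
next
  show "block_proj m T \<one>\<^bsub>RI m\<^esub> = \<one>\<^bsub>block_ring T\<^esub>"
    using ring_hom_memE(4)[OF rho_hom(1)[OF assms(1,2)]] assms(3)
    by (auto simp: block_proj_def intro!: restrict_ext simp del: RI_simps)
qed

text \<open>The arithmetic of q enters the decomposition through \<open>card_mu_eq\<close>: the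
  polynomial x^m - 1 has m distinct roots in the field.\<close>

locale block_system =
  fixes m :: nat and Z :: "'k::field set"
  assumes m: "m \<ge> 2" "even m"
    and card_mu_eq: "card (mu m :: 'k set) = m"
    and reps: "block_reps m Z"
begin

lemma finite_mu: "finite (mu m :: 'k set)"
  using m(1) card_mu_eq by (intro card_ge_0_finite) auto

lemma Z_mu: "Z \<subseteq> mu m"
  using reps by (simp add: block_reps_def)

lemma uminus_notin_Z: "z \<in> Z \<Longrightarrow> - z \<notin> Z"
  using reps by (auto simp: block_reps_def)

lemma mu_cases: "z \<in> mu m \<Longrightarrow> z \<in> Z \<or> - z \<in> Z"
  using reps by (auto simp: block_reps_def)

text \<open>The four entries of \<open>f z\<close> prescribe the values of two polynomials at
  \<open>z\<close> and \<open>- z\<close>. The prescriptions for different blocks do not collide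
  because \<open>T\<close> never contains both \<open>z\<close> and \<open>- z\<close>, so
  interpolation on \<open>mu m\<close> applies.\<close>

lemma block_proj_surj:
  assumes "T \<subseteq> Z" "f \<in> carrier (block_ring T)"
  shows "\<exists>x\<in>carrier (RI m). block_proj m T x = f"
proof -
  have ex: "\<exists>p. degree p < m \<and> (\<forall>w\<in>mu m. poly p w = g w)" for g :: "'k \<Rightarrow> 'k"
    using poly_interpolation[OF finite_mu, of g] m(1) unfolding card_mu_eq
    by (metis One_nat_def Suc_pred le_imp_less_Suc less_le_trans pos2)
  \<comment> \<open>If \<open>w\<close> is not in \<open>T\<close> but \<open>- w\<close> is, the
    value at \<open>w\<close> is the lower right entry of block \<open>- w\<close>. If neither is in
    \<open>T\<close>, the value is arbitrary.\<close>
  obtain a where a: "degree a < m"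
      "\<forall>w\<in>mu m. poly a w = (if w \<in> T then f w $$ (0, 0) else f (- w) $$ (1, 1))"
    using ex[of "\<lambda>w. if w \<in> T then f w $$ (0, 0) else f (- w) $$ (1, 1)"] by blast
  obtain b where b: "degree b < m"
      "\<forall>w\<in>mu m. poly b w = (if w \<in> T then - f w $$ (0, 1) else f (- w) $$ (1, 0))"
    using ex[of "\<lambda>w. if w \<in> T then - f w $$ (0, 1) else f (- w) $$ (1, 0)"] by blast
  have x: "(a, b) \<in> carrier (RI m)" using a b by simp
  have "rho m z (a, b) = f z" if z: "z \<in> T" for z
  proof (rule M2_eqI)
    have "z \<in> mu m" "- z \<in> mu m" "- z \<notin> T"
      using z assms(1) Z_mu uminus_notin_Z[of z] uminus_mu[OF m(2), of z] by auto
    then show "rho m z (a, b) $$ (0, 0) = f z $$ (0, 0)" "rho m z (a, b) $$ (0, 1) = f z $$ (0, 1)"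
      "rho m z (a, b) $$ (1, 0) = f z $$ (1, 0)" "rho m z (a, b) $$ (1, 1) = f z $$ (1, 1)"
      unfolding rho_index[OF x] using a(2) b(2) z by simp_all
    show "f z \<in> carrier M2" using assms(2) z by auto
  qed (rule rho_index[OF x])
  then have "block_proj m T (a, b) = f"
    using assms(2) by (auto simp: block_proj_def fun_eq_iff PiE_iff extensional_def)
  then show ?thesis using x by blast
qed

text \<open>Block \<open>z\<close> determines both polynomials at \<open>z\<close> and at
  \<open>- z\<close>, so the blocks in \<open>Z\<close> determine them on all of
  \<open>mu m\<close>: m points, against degree less than m.\<close>

lemma rho_eqD:
  assumes x: "x \<in> carrier (RI m)" and y: "y \<in> carrier (RI m)"
    and eq: "\<And>z. z \<in> Z \<Longrightarrow> rho m z x = rho m z y"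
  shows "x = y"
proof -
  have "poly (fst x) z = poly (fst y) z \<and> poly (snd x) z = poly (snd y) z" if "z \<in> mu m" for z
    using mu_cases[OF that]
  proof
    assume "z \<in> Z"
    from eq[OF this] show ?thesis
      using rho_index(2,3)[OF x, of z] rho_index(2,3)[OF y, of z] by simp
  next
    assume "- z \<in> Z"
    from eq[OF this] show ?thesis
      using rho_index(4,5)[OF x, of "- z"] rho_index(4,5)[OF y, of "- z"] by simp
  qed
  then have "fst x = fst y" "snd x = snd y"
    using x y by (auto intro!: poly_eqI_degree[of "mu m"] simp: card_mu_eq)
  then show ?thesis by (simp add: prod_eq_iff)
qed

lemma block_proj_iso: "block_proj m Z \<in> ring_iso (RI m) (block_ring Z)"
proof -
  have hom: "block_proj m Z \<in> Ring.ring_hom (RI m) (block_ring Z)"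
    by (rule block_proj_hom[OF m Z_mu])
  have "inj_on (block_proj m Z) (carrier (RI m))"
  proof (rule inj_onI)
    fix x y assume xy: "x \<in> carrier (RI m)" "y \<in> carrier (RI m)" "block_proj m Z x = block_proj m Z y"
    show "x = y"
      by (rule rho_eqD[OF xy(1,2)]) (use xy(3) in \<open>metis block_proj_def restrict_apply'\<close>)
  qed
  moreover have "block_proj m Z ` carrier (RI m) = carrier (block_ring Z)"
    using block_proj_surj[OF order_refl] ring_hom_memE(1)[OF hom] by blast
  ultimately show ?thesis
    using hom by (auto simp: ring_iso_def bij_betw_def)
qed

section \<open>Two-sided ideals and quotients\<close>

lemma ex_blocks:
  assumes "\<And>z. z \<in> Z \<Longrightarrow> f z \<in> carrier M2"
  shows "\<exists>x\<in>carrier (RI m). \<forall>z\<in>Z. rho m z x = f z"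
proof -
  have "restrict f Z \<in> carrier (block_ring Z)" using assms by auto
  then obtain x where "x \<in> carrier (RI m)" "block_proj m Z x = restrict f Z"
    using block_proj_surj[OF order_refl] by blast
  then show ?thesis by (metis block_proj_def restrict_apply')
qed

text \<open>
  If \<open>c\<close> is a nonzero entry of \<open>Y\<close> at \<open>(i, j)\<close>, then, with matrix units \<open>E\<^sub>k\<^sub>l\<close>,
  \<open>\<Sum>\<^sub>k (c\<^sup>-\<^sup>1 E\<^sub>k\<^sub>i) Y E\<^sub>j\<^sub>k = 1\<close>.
\<close>

lemma block_idempotent_in_ideal:
  assumes I: "ideal I (RI m)" and y: "y \<in> I" and z: "z \<in> Z"
    and nz: "rho m z y \<noteq> \<zero>\<^bsub>M2\<^esub>"
  shows "\<exists>e\<in>I. \<forall>w\<in>Z. rho m w e = (if w = z then \<one>\<^bsub>M2\<^esub> else \<zero>\<^bsub>M2\<^esub>)"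
proof -
  interpret I: ideal I "RI m" by fact
  interpret M: ring "M2 :: ('k, 'k mat) module"
    using M2_algebra by (rule unital_algebra.axioms)
  have yc: "y \<in> carrier (RI m)" by (rule I.a_Hcarr[OF y])
  let ?Y = "rho m z y"
  have Yc: "?Y \<in> carrier M2" by (rule rho_index[OF yc])
  have "\<exists>i<2. \<exists>j<2. ?Y $$ (i, j) \<noteq> 0"
  proof (rule ccontr)
    assume "\<not> ?thesis"
    then have "?Y $$ (k, l) = \<zero>\<^bsub>M2\<^esub> $$ (k, l)" if "k < 2" "l < 2" for k l
      using that by (auto simp: module_mat_simps)
    then have "?Y = \<zero>\<^bsub>M2\<^esub>" by (intro M2_eqI[OF Yc M.zero_closed]) auto
    then show False using nz by simp
  qed
  then obtain i j where ij: "i < 2" "j < 2" "?Y $$ (i, j) \<noteq> 0" by blast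
  define E where "E c r s = mat 2 2 (\<lambda>p. if p = (r, s) then c else 0 :: 'k)" for c r s
  have Ec: "E c r s \<in> carrier M2" for c r s
    by (simp add: E_def module_mat_simps)
  have "\<exists>x\<in>carrier (RI m). \<forall>w\<in>Z. rho m w x = (if w = z then E c r s else \<zero>\<^bsub>M2\<^esub>)" for c r s
    using ex_blocks[of "\<lambda>w. if w = z then E c r s else \<zero>\<^bsub>M2\<^esub>"] Ec by auto
  then obtain X where X: "\<And>c r s. X c r s \<in> carrier (RI m)"
    "\<And>c r s w. w \<in> Z \<Longrightarrow> rho m w (X c r s) = (if w = z then E c r s else \<zero>\<^bsub>M2\<^esub>)"
    by metis
  \<comment> \<open>In block \<open>z\<close> this is the diagonal matrix unit at
    \<open>(k, k)\<close>; in every other block both outer factors vanish. Hence \<open>u 0\<close>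
    and \<open>u 1\<close> add up to the idempotent of block \<open>z\<close>.\<close>
  define u where "u k = X (inverse (?Y $$ (i, j))) k i \<otimes>\<^bsub>RI m\<^esub> y \<otimes>\<^bsub>RI m\<^esub> X 1 j k" for k
  have uI: "u k \<in> I" for k
    unfolding u_def by (intro I.I_l_closed I.I_r_closed y X)
  note uc = I.a_Hcarr[OF uI]
  have "rho m w (u 0 \<oplus>\<^bsub>RI m\<^esub> u 1) = (if w = z then \<one>\<^bsub>M2\<^esub> else \<zero>\<^bsub>M2\<^esub>)"
    if w: "w \<in> Z" for w
  proof -
    have wmu: "w \<in> mu m" using w Z_mu by blast
    note hom = ring_hom_memE[OF rho_hom(1)[OF m wmu]]
    have ru: "rho m w (u k) = rho m w (X (inverse (?Y $$ (i, j))) k i) \<otimes>\<^bsub>M2\<^esub> rho m w y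
        \<otimes>\<^bsub>M2\<^esub> rho m w (X 1 j k)" for k
      unfolding u_def by (simp add: hom(2) I.m_closed X(1) yc del: RI_simps)
    have r: "rho m w (u 0 \<oplus>\<^bsub>RI m\<^esub> u 1) = rho m w (u 0) \<oplus>\<^bsub>M2\<^esub> rho m w (u 1)"
      by (rule hom(3)[OF uc uc])
    show ?thesis
    proof (cases "w = z")
      case True
      have "E (inverse (?Y $$ (i, j))) 0 i \<otimes>\<^bsub>M2\<^esub> ?Y \<otimes>\<^bsub>M2\<^esub> E 1 j 0 \<oplus>\<^bsub>M2\<^esub>
          E (inverse (?Y $$ (i, j))) 1 i \<otimes>\<^bsub>M2\<^esub> ?Y \<otimes>\<^bsub>M2\<^esub> E 1 j 1 = \<one>\<^bsub>M2\<^esub>"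
        using ij Yc
        by (auto simp: module_mat_simps E_def less_2_iff scalar_prod_def numeral_2_eq_2
            intro!: eq_matI)
      then show ?thesis unfolding r ru X(2)[OF w] using True by simp
    next
      case False
      then show ?thesis using rho_index(1)[OF yc, of w] w by (simp add: r ru X(2) del: One_nat_def)
    qed
  qed
  moreover have "u 0 \<oplus>\<^bsub>RI m\<^esub> u 1 \<in> I" by (intro additive_subgroup.a_closed[OF I.additive_subgroup_axioms] uI)
  ultimately show ?thesis by blast
qed

text \<open>Induction on \<open>S\<close>: the idempotent \<open>e\<close> of a new block
  \<open>z\<close> lies in \<open>I\<close>. Then \<open>x\<close> is the sum of \<open>x'\<close>,
  its copy with block \<open>z\<close> erased, which the induction hypothesis covers, and the
  product of \<open>x\<close> and \<open>e\<close>, which is block \<open>z\<close> of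
  \<open>x\<close>.\<close>

lemma mem_ideal_of_blocks:
  assumes I: "ideal I (RI m)" and "finite S" "S \<subseteq> Z"
    and "\<And>z. z \<in> S \<Longrightarrow> \<exists>y\<in>I. rho m z y \<noteq> \<zero>\<^bsub>M2\<^esub>"
    and "x \<in> carrier (RI m)" "\<And>w. w \<in> Z - S \<Longrightarrow> rho m w x = \<zero>\<^bsub>M2\<^esub>"
  shows "x \<in> I"
  using assms(2-)
proof (induction S arbitrary: x)
  interpret I: ideal I "RI m" by fact
  case empty
  have "x = \<zero>\<^bsub>RI m\<^esub>"
  proof (rule rho_eqD[OF empty(3) I.zero_closed])
    fix w assume w: "w \<in> Z"
    then have wmu: "w \<in> mu m" using Z_mu by blast
    have "rho m w \<zero>\<^bsub>RI m\<^esub> = \<zero>\<^bsub>M2\<^esub>"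
      by (rule ring_hom_zero[OF rho_hom(1)[OF m wmu] I.ring_axioms])
        (use M2_algebra in \<open>rule unital_algebra.axioms\<close>)
    then show "rho m w x = rho m w \<zero>\<^bsub>RI m\<^esub>" using empty(4)[of w] w by simp
  qed
  then show ?case using additive_subgroup.zero_closed[OF I.additive_subgroup_axioms] by (simp only:)
next
  case (insert z S x)
  interpret I: ideal I "RI m" by fact
  interpret M: ring "M2 :: ('k, 'k mat) module"
    using M2_algebra by (rule unital_algebra.axioms)
  have z: "z \<in> Z" using insert.prems by blast
  obtain y where y: "y \<in> I" "rho m z y \<noteq> \<zero>\<^bsub>M2\<^esub>" using insert.prems(2)[of z] by blast
  obtain e where e: "e \<in> I"
      "\<And>w. w \<in> Z \<Longrightarrow> rho m w e = (if w = z then \<one>\<^bsub>M2\<^esub> else \<zero>\<^bsub>M2\<^esub>)"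
    using block_idempotent_in_ideal[OF I y(1) z y(2)] by (elim bexE) blast
  note ec = I.a_Hcarr[OF e(1)]
  have rc: "rho m w x \<in> carrier M2" for w by (rule rho_index[OF insert.prems(3)])
  have "\<exists>y\<in>carrier (RI m). \<forall>w\<in>Z. rho m w y = (if w = z then \<zero>\<^bsub>M2\<^esub> else rho m w x)"
    by (rule ex_blocks) (simp add: rc)
  then obtain x' where x': "x' \<in> carrier (RI m)"
      "\<And>w. w \<in> Z \<Longrightarrow> rho m w x' = (if w = z then \<zero>\<^bsub>M2\<^esub> else rho m w x)"
    by (elim bexE) blast
  have x'I: "x' \<in> I"
    by (rule insert.IH) (use insert.prems x' in auto)
  have xe: "x \<otimes>\<^bsub>RI m\<^esub> e \<in> I" by (rule I.I_l_closed[OF e(1) insert.prems(3)])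
  have "x = x' \<oplus>\<^bsub>RI m\<^esub> (x \<otimes>\<^bsub>RI m\<^esub> e)"
  proof (rule rho_eqD[OF insert.prems(3)])
    show "x' \<oplus>\<^bsub>RI m\<^esub> x \<otimes>\<^bsub>RI m\<^esub> e \<in> carrier (RI m)"
      by (intro I.add.m_closed I.a_Hcarr[OF xe] x')
    fix w assume w: "w \<in> Z"
    then have wmu: "w \<in> mu m" using Z_mu by blast
    note hom = ring_hom_memE[OF rho_hom(1)[OF m wmu]]
    show "rho m w x = rho m w (x' \<oplus>\<^bsub>RI m\<^esub> x \<otimes>\<^bsub>RI m\<^esub> e)"
      unfolding hom(3)[OF x'(1) I.a_Hcarr[OF xe]] hom(2)[OF insert.prems(3) ec]
      using w rc by (simp add: x'(2) e(2))
  qed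
  also have "\<dots> \<in> I" by (intro additive_subgroup.a_closed[OF I.additive_subgroup_axioms] x'I xe)
  finally show ?case .
qed

text \<open>Take for \<open>T\<close> the blocks on which \<open>I\<close> vanishes. On every block
  in \<open>Z - T\<close> some element of \<open>I\<close> is nonzero, so
  \<open>mem_ideal_of_blocks\<close> identifies the kernel of the projection to \<open>T\<close>
  with \<open>I\<close>, and the first isomorphism theorem applies.\<close>

lemma quotient_iso_blocks:
  assumes I: "ideal I (RI m)"
  shows "\<exists>T\<subseteq>Z. \<exists>\<phi> \<in> ring_iso (RI m Quot I) (block_ring T).
    \<forall>x \<in> carrier (RI m). \<phi> (I +>\<^bsub>RI m\<^esub> x) = block_proj m T x"
proof -
  interpret I: ideal I "RI m" by fact
  define T where "T = {z \<in> Z. \<forall>y\<in>I. rho m z y = \<zero>\<^bsub>M2\<^esub>}"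
  have T: "T \<subseteq> Z" by (auto simp: T_def)
  have hom: "block_proj m T \<in> Ring.ring_hom (RI m) (block_ring T)"
    by (rule block_proj_hom) (use m T Z_mu in auto)
  interpret h: ring_hom_ring "RI m" "block_ring T" "block_proj m T"
    by (rule ring_hom_ringI2[OF I.ring_axioms ring_block_ring hom])
  have "x \<in> I" if x: "x \<in> carrier (RI m)" "block_proj m T x = \<zero>\<^bsub>block_ring T\<^esub>" for x
  proof (rule mem_ideal_of_blocks[OF I _ _ _ x(1), of "Z - T"])
    show "finite (Z - T)" using finite_mu Z_mu by (meson finite_Diff finite_subset)
    fix w assume "w \<in> Z - (Z - T)"
    then have "w \<in> T" by blast
    then show "rho m w x = \<zero>\<^bsub>M2\<^esub>"
      using fun_cong[OF x(2), of w] by (simp add: block_proj_def)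
  qed (auto simp: T_def)
  moreover have "block_proj m T x = \<zero>\<^bsub>block_ring T\<^esub>" if "x \<in> I" for x
    using that by (auto simp: block_proj_def T_def intro!: restrict_ext)
  ultimately have ker: "a_kernel (RI m) (block_ring T) (block_proj m T) = I"
    using I.a_Hcarr unfolding a_kernel_def' by blast
  have "block_proj m T ` carrier (RI m) = carrier (block_ring T)"
    using block_proj_surj[OF T] h.hom_closed by blast
  \<comment> \<open>The induced isomorphism sends a coset to the single value of
    \<open>block_proj m T\<close> on it; \<open>the_elem_simp\<close> evaluates it on the coset of
    \<open>x\<close>.\<close>
  note iso = h.FactRing_iso_set[OF this, unfolded ker]
  show ?thesis
    by (intro exI[of _ T] conjI T bexI[OF _ iso] ballI h.the_elem_simp[unfolded ker])
qed

lemma rho_surj: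
  assumes "z \<in> Z"
  shows "rho m z ` carrier (RI m) = carrier M2"
proof -
  have "\<exists>x\<in>carrier (RI m). rho m z x = M" if "M \<in> carrier M2" for M
    using ex_blocks[of "\<lambda>_. M"] that assms by blast
  then show ?thesis using rho_index(1) by blast
qed

end


section \<open>Norms\<close>

lemma centred_of_int:
  fixes n :: int
  assumes "odd CARD('p::prime_card)" "2 * \<bar>n\<bar> < int CARD('p)"
  shows "centred (of_int n :: 'p mod_ring) = n"
proof -
  let ?c = "centred (of_int n :: 'p mod_ring)"
  have "of_int (?c - n) = (0 :: 'p mod_ring)" using centred(1)[OF assms(1)] by simp
  \<comment> \<open>Two lifts of one residue differ by a multiple of q, and the size bounds leave
    only the multiple 0.\<close>
  then have "int CARD('p) dvd ?c - n"
    by (metis of_int_eq_0_iff_char_dvd semiring_char_mod_ring)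
  moreover have "\<bar>?c - n\<bar> < int CARD('p)"
    using centred(2)[OF assms(1), of "of_int n"] assms(2) by linarith
  ultimately show ?thesis
    using dvd_imp_le_int[of "?c - n" "int CARD('p)"] by (cases "?c = n") auto
qed

text \<open>The centred lift is the smallest one: either \<open>n\<close> is already centred, or |n|
  is at least q/2.\<close>

lemma centred_of_int_le:
  fixes n :: int
  assumes "odd CARD('p::prime_card)"
  shows "\<bar>centred (of_int n :: 'p mod_ring)\<bar> \<le> \<bar>n\<bar>"
  using centred_of_int[OF assms, of n] centred(2)[OF assms, of "of_int n"]
  by (cases "2 * \<bar>n\<bar> < int CARD('p)") auto

lemma centred_le_of_eq:
  fixes y :: "'p::prime_card mod_ring"
  assumes "odd CARD('p)" "y = of_int n"
  shows "\<bar>centred y\<bar> \<le> \<bar>n\<bar>"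
  using centred_of_int_le[OF assms(1), of n] assms(2) by simp

lemma centred_minus:
  fixes y :: "'p::prime_card mod_ring"
  assumes "odd CARD('p)"
  shows "centred (- y) = - centred y"
  using centred_of_int[OF assms, of "- centred y"] centred[OF assms, of y] by simp

lemma centred_0_1:
  assumes "odd CARD('p::prime_card)"
  shows "centred (0 :: 'p mod_ring) = 0" "centred (1 :: 'p mod_ring) = 1"
proof -
  have "CARD('p) \<noteq> 1" "CARD('p) \<noteq> 2" using assms prime_card[where 'a = 'p] by auto
  then have "2 < int CARD('p)" using prime_gt_1_nat[OF prime_card[where 'a = 'p]] by linarith
  then show "centred (0 :: 'p mod_ring) = 0" "centred (1 :: 'p mod_ring) = 1"
    using centred_of_int[OF assms, of 0] centred_of_int[OF assms, of 1] by auto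
qed

section \<open>Matrix and coefficient norms\<close>

lemma elements_mat_M2:
  assumes "M \<in> carrier M2"
  shows "elements_mat M = {M $$ (0, 0), M $$ (0, 1), M $$ (1, 0), M $$ (1, 1)}"
  using assms
  by (auto simp: elements_mat_def module_mat_simps upt_rec numeral_2_eq_2)

lemma mat_norm_M2:
  assumes "M \<in> carrier M2"
  shows "mat_norm M = Max {\<bar>centred (M $$ (0, 0))\<bar>, \<bar>centred (M $$ (0, 1))\<bar>,
    \<bar>centred (M $$ (1, 0))\<bar>, \<bar>centred (M $$ (1, 1))\<bar>}"
  by (simp add: mat_norm_def elements_mat_M2[OF assms])

lemma coef_norm_ge:
  assumes "i < m"
  shows "\<bar>centred (coeff (fst x) i)\<bar> \<le> coef_norm m x" "\<bar>centred (coeff (snd x) i)\<bar> \<le> coef_norm m x"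
proof -
  have "max \<bar>centred (coeff (fst x) i)\<bar> \<bar>centred (coeff (snd x) i)\<bar> \<le> coef_norm m x"
    unfolding coef_norm_def using assms by (intro Max_ge) auto
  then show "\<bar>centred (coeff (fst x) i)\<bar> \<le> coef_norm m x" "\<bar>centred (coeff (snd x) i)\<bar> \<le> coef_norm m x"
    by auto
qed

text \<open>Centred lifts are integers, and only the residue 0 lifts to 0. The denominators in
  \<open>distortion\<close> are therefore at least 1.\<close>

lemma coef_norm_pos:
  fixes x :: "'p::prime_card mod_ring poly \<times> 'p mod_ring poly"
  assumes "odd CARD('p)" "x \<in> carrier (RI m)" "x \<noteq> \<zero>\<^bsub>RI m\<^esub>"
  shows "coef_norm m x \<ge> 1"
proof (rule ccontr)
  assume "\<not> coef_norm m x \<ge> 1"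
  then have "centred (coeff (fst x) i) = 0 \<and> centred (coeff (snd x) i) = 0" if "i < m" for i
    using coef_norm_ge[OF that, of x] by linarith
  then have "coeff (fst x) i = 0 \<and> coeff (snd x) i = 0" if "i < m" for i
    using that centred(1)[OF assms(1), of "coeff (fst x) i"]
      centred(1)[OF assms(1), of "coeff (snd x) i"] by simp
  moreover have "coeff (fst x) i = 0 \<and> coeff (snd x) i = 0" if "i \<ge> m" for i
    using that assms(2) by (auto intro!: coeff_eq_0)
  ultimately have "fst x = 0" "snd x = 0"
    by (metis not_le poly_eqI coeff_0)+
  then show False using assms(3) by (simp add: prod_eq_iff)
qed

text \<open>Lifting the coefficients gives an integer sum of m signed terms, bounded by the triangle
  inequality; passing to the centred lift of its residue cannot increase the absolute value.\<close>

lemma centred_poly_sign_le: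
  fixes a :: "'p::prime_card mod_ring poly"
  assumes odd: "odd CARD('p)" and a: "degree a < m"
    and le: "\<And>i. i < m \<Longrightarrow> \<bar>centred (coeff a i)\<bar> \<le> c" and u: "\<bar>u\<bar> = 1"
  shows "\<bar>centred (poly a (of_int u))\<bar> \<le> int m * c"
proof -
  let ?n = "\<Sum>i<m. centred (coeff a i) * u ^ i"
  have "{..degree a} \<subseteq> {..<m}" using a by auto
  then have "poly a (of_int u) = (\<Sum>i<m. coeff a i * of_int u ^ i)"
    unfolding poly_altdef by (rule sum.mono_neutral_left[rotated]) (auto simp: coeff_eq_0)
  also have "\<dots> = of_int ?n" by (simp add: centred(1)[OF odd])
  finally have "\<bar>centred (poly a (of_int u))\<bar> \<le> \<bar>?n\<bar>" by (rule centred_le_of_eq[OF odd])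
  also have "\<dots> \<le> (\<Sum>i<m. \<bar>centred (coeff a i) * u ^ i\<bar>)" by (rule sum_abs)
  also have "\<dots> \<le> (\<Sum>i<m. c)"
    using le u by (intro sum_mono) (auto simp: abs_mult power_abs)
  finally show ?thesis by simp
qed

lemma centred_large_or_inverse_large:
  fixes z w :: "'p::prime_card mod_ring"
  assumes odd: "odd CARD('p)" and zw: "z * w = 1" and z: "z \<noteq> 1" "z \<noteq> - 1"
  shows "sqrt (real CARD('p) / 2) \<le> \<bar>centred z\<bar> \<or> sqrt (real CARD('p) / 2) \<le> \<bar>centred w\<bar>"
proof (rule ccontr)
  let ?q = "real CARD('p)"
  assume "\<not> ?thesis"
  then have lt: "real_of_int \<bar>centred z\<bar> < sqrt (?q / 2)" "real_of_int \<bar>centred w\<bar> < sqrt (?q / 2)"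
    by auto
  have "real_of_int \<bar>centred z\<bar> * real_of_int \<bar>centred w\<bar> < sqrt (?q / 2) * sqrt (?q / 2)"
    by (rule mult_strict_mono'[OF lt]) auto
  then have "real_of_int (2 * \<bar>centred z * centred w\<bar>) < real_of_int (int CARD('p))"
    by (simp add: abs_mult)
  then have "2 * \<bar>centred z * centred w\<bar> < int CARD('p)" by (simp only: of_int_less_iff)
  \<comment> \<open>Being below q/2 in absolute value, the integer product is itself the centred
    lift of \<open>z * w\<close>, which is 1. Its factors are then units of the integers.\<close>
  from centred_of_int[OF odd this] have "centred z * centred w = 1"
    using zw centred(1)[OF odd] centred_0_1(2)[OF odd] by simp
  then have "centred z = 1 \<or> centred z = - 1"
    by (auto simp: zmult_eq_1_iff)
  then show False
    using z centred(1)[OF odd, of z] by auto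
qed

lemma RI_s_pow:
  assumes "j < m" "m \<ge> 2"
  shows "RI_s [^]\<^bsub>RI m\<^esub> j = (monom 1 j :: 'k::field poly, 0)"
  using assms(1)
proof (induction j)
  case 0
  then show ?case by (simp add: nat_pow_def)
next
  case (Suc j)
  then show ?case
    by (simp add: nat_pow_def RI_s_def mult_monom mod_RI_id degree_monom_eq)
qed

lemma coef_norm_monom:
  assumes "odd CARD('p::prime_card)" "j < m"
  shows "coef_norm m (monom 1 j :: 'p mod_ring poly, 0) = 1"
  unfolding coef_norm_def
proof (rule Max_eqI)
  show "1 \<in> (\<lambda>i. max \<bar>centred (coeff (fst (monom 1 j :: 'p mod_ring poly, 0 :: 'p mod_ring poly)) i)\<bar>
      \<bar>centred (coeff (snd (monom 1 j :: 'p mod_ring poly, 0 :: 'p mod_ring poly)) i)\<bar>) ` {..<m}"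
    using assms by (intro image_eqI[of _ _ j]) (auto simp: centred_0_1)
qed (auto simp: centred_0_1[OF assms(1)] coeff_monom)

lemma mat_norm_le_iff:
  assumes "M \<in> carrier M2"
  shows "mat_norm M \<le> c \<longleftrightarrow> (\<forall>i<2. \<forall>j<2. \<bar>centred (M $$ (i, j))\<bar> \<le> c)"
  using assms by (auto simp: mat_norm_M2 less_2_iff)

lemma centred_le_mat_norm_rho:
  assumes "x \<in> carrier (RI m)"
  shows "\<bar>centred (poly (fst x) z)\<bar> \<le> mat_norm (rho m z x)"
  by (simp add: mat_norm_M2[OF rho_index(1)[OF assms]] rho_index(2)[OF assms])

text \<open>Up to sign, the entries are values of the two polynomials at 1 and -1, where
  \<open>centred_poly_sign_le\<close> applies.\<close>

lemma mat_norm_rho_1_le: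
  fixes x :: "'p::prime_card mod_ring poly \<times> 'p mod_ring poly"
  assumes odd: "odd CARD('p)" and x: "x \<in> carrier (RI m)"
  shows "mat_norm (rho m 1 x) \<le> int m * coef_norm m x"
proof -
  have *: "\<bar>centred (poly p (of_int u))\<bar> \<le> int m * coef_norm m x"
    if "\<bar>u\<bar> = 1" "p = fst x \<or> p = snd x" for u p
    using that x coef_norm_ge[of _ m x] by (intro centred_poly_sign_le[OF odd]) auto
  show ?thesis
    unfolding mat_norm_M2[OF rho_index(1)[OF x]] rho_index(2-5)[OF x] centred_minus[OF odd]
    using *[of 1] *[of "- 1"] by simp
qed

text \<open>A crude bound, used to show that the supremum in \<open>distortion\<close> is over a
  bounded set.\<close>

lemma mat_norm_le_card:
  fixes M :: "'p::prime_card mod_ring mat"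
  assumes "odd CARD('p)" "M \<in> carrier M2"
  shows "mat_norm M \<le> int CARD('p)"
proof -
  have "\<bar>centred y\<bar> \<le> int CARD('p)" for y :: "'p mod_ring"
    using centred(2)[OF assms(1), of y] by linarith
  then show ?thesis by (simp add: mat_norm_le_iff[OF assms(2)])
qed

section \<open>Bounds on the distortion\<close>

lemma tuple_norm_le_iff:
  fixes T :: "'p::prime_card mod_ring set"
  shows "tuple_norm T f \<le> c \<longleftrightarrow> 0 \<le> c \<and> (\<forall>z\<in>T. mat_norm (f z) \<le> c)"
  by (auto simp: tuple_norm_def)

lemma distortion_ge:
  fixes x :: "'p::prime_card mod_ring poly \<times> 'p mod_ring poly"
  assumes odd: "odd CARD('p)" and x: "x \<in> carrier (RI m)" "x \<noteq> \<zero>\<^bsub>RI m\<^esub>" and z: "z \<in> T"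
  shows "real_of_int (mat_norm (rho m z x)) / real_of_int (coef_norm m x) \<le> distortion m T"
proof -
  let ?r = "\<lambda>x. real_of_int (tuple_norm T (block_proj m T x)) / real_of_int (coef_norm m x)"
  have pos: "1 \<le> coef_norm m y" if "y \<in> carrier (RI m) - {\<zero>\<^bsub>RI m\<^esub>}"
    for y :: "'p mod_ring poly \<times> 'p mod_ring poly"
    using that by (intro coef_norm_pos[OF odd]) auto
  \<comment> \<open>A real supremum dominates its members only when the set is bounded. Here
    numerators are at most q and denominators at least 1.\<close>
  have "bdd_above (?r ` (carrier (RI m) - {\<zero>\<^bsub>RI m\<^esub>}))"
  proof (rule bdd_aboveI2)
    fix y :: "'p mod_ring poly \<times> 'p mod_ring poly"
    assume y: "y \<in> carrier (RI m) - {\<zero>\<^bsub>RI m\<^esub>}"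
    have "tuple_norm T (block_proj m T y) \<le> int CARD('p)"
      using y by (simp add: tuple_norm_le_iff block_proj_def mat_norm_le_card[OF odd] rho_index(1)
          del: RI_simps)
    also have "\<dots> \<le> int CARD('p) * coef_norm m y"
      using pos[OF y] by simp
    finally have "real_of_int (tuple_norm T (block_proj m T y)) \<le> real CARD('p) * real_of_int (coef_norm m y)"
      by (metis of_int_le_iff of_int_mult of_int_of_nat_eq)
    then show "?r y \<le> real CARD('p)"
      using pos[OF y] by (simp add: divide_le_eq)
  qed
  then have "?r x \<le> distortion m T"
    unfolding distortion_def using x by (intro cSUP_upper) auto
  moreover have "mat_norm (rho m z x) \<le> tuple_norm T (block_proj m T x)"
    using tuple_norm_le_iff[of T "block_proj m T x"] z by (auto simp: block_proj_def)
  ultimately show ?thesis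
    using pos[of x] x
      divide_right_mono[of "real_of_int (mat_norm (rho m z x))"
        "real_of_int (tuple_norm T (block_proj m T x))" "real_of_int (coef_norm m x)"]
    by (simp del: RI_simps)
qed

lemma distortion_1_le:
  assumes odd: "odd CARD('p::prime_card)" and m: "m > 0"
  shows "distortion m {1 :: 'p mod_ring} \<le> real m"
  unfolding distortion_def
proof (rule cSUP_least)
  \<comment> \<open>The unit of the algebra witnesses that the supremum is over a nonempty set, as
    \<open>cSUP_least\<close> demands.\<close>
  have "(1, 0) \<in> carrier (RI m) - {\<zero>\<^bsub>RI m\<^esub> :: 'p mod_ring poly \<times> 'p mod_ring poly}"
    using m by simp
  then show "carrier (RI m) - {\<zero>\<^bsub>RI m\<^esub> :: 'p mod_ring poly \<times> 'p mod_ring poly} \<noteq> {}"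
    by blast
  fix x :: "'p mod_ring poly \<times> 'p mod_ring poly"
  assume x: "x \<in> carrier (RI m) - {\<zero>\<^bsub>RI m\<^esub>}"
  then have pos: "1 \<le> coef_norm m x" by (intro coef_norm_pos[OF odd]) auto
  then have "tuple_norm {1} (block_proj m {1} x) \<le> int m * coef_norm m x"
    using mat_norm_rho_1_le[OF odd, of x m] x
    by (simp add: tuple_norm_le_iff block_proj_def del: RI_simps)
  then have "real_of_int (tuple_norm {1} (block_proj m {1} x)) \<le> real m * real_of_int (coef_norm m x)"
    by (metis of_int_le_iff of_int_mult of_int_of_nat_eq)
  then show "real_of_int (tuple_norm {1} (block_proj m {1} x)) / real_of_int (coef_norm m x) \<le> real m"
    using pos by (simp add: divide_le_eq)
qed

section \<open>Powers of a root of unity\<close>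

lemma ord_mu:
  fixes z :: "'k::field"
  assumes "m > 0" "z \<in> mu m"
  defines "d \<equiv> group.ord (units_of class_ring) z"
  shows "z ^ d = 1" "d > 0" "d \<le> m"
proof -
  interpret group "units_of (class_ring :: 'k ring)" by (rule group_units_class_ring)
  have "z \<noteq> 0" using assms by (auto simp: mu_def power_0_left)
  then have z: "z \<in> carrier (units_of class_ring)" by (simp add: carrier_units_class_ring)
  have iff: "z ^ n = 1 \<longleftrightarrow> d dvd n" for n
    using pow_eq_id[OF z, of n] by (simp add: d_def pow_units_class_ring units_of_one)
  show "z ^ d = 1" by (simp add: iff)
  \<comment> \<open>The resulting bound \<open>d \<le> m\<close> ensures that powers of s with
    exponent below \<open>d\<close> need no reduction modulo s^m - 1.\<close>
  have "d dvd m" using assms(2) iff by (simp add: mu_def)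
  then show "d > 0" "d \<le> m" using assms(1) by (auto intro: dvd_imp_le dvd_pos_nat)
qed

text \<open>The exponent is 1 or \<open>d - 1\<close>, since \<open>z ^ (d - 1)\<close> is the
  inverse of \<open>z\<close>. Both are below \<open>d\<close> because \<open>z \<noteq> 1\<close>
  gives \<open>d > 1\<close>.\<close>

lemma ex_large_power:
  fixes z :: "'p::prime_card mod_ring"
  assumes odd: "odd CARD('p)" and m: "m \<ge> 2" and z: "z \<in> mu m" "z \<notin> {1, - 1}"
  defines "d \<equiv> group.ord (units_of class_ring) z"
  shows "\<exists>j<d. sqrt (real CARD('p) / 2) \<le> real_of_int \<bar>centred (z ^ j)\<bar>"
proof -
  note ord = ord_mu[OF _ z(1), folded d_def]
  have "d \<noteq> 1" using ord(1) m z(2) by auto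
  then have d: "1 < d" "d - 1 < d" using ord(2) m by auto
  then have "z * z ^ (d - 1) = 1"
    using ord(1) m by (simp flip: power_Suc)
  then have "sqrt (real CARD('p) / 2) \<le> \<bar>centred z\<bar> \<or>
      sqrt (real CARD('p) / 2) \<le> \<bar>centred (z ^ (d - 1))\<bar>"
    using z(2) by (intro centred_large_or_inverse_large[OF odd]) auto
  then show ?thesis
    using d by (metis power_one_right)
qed

text \<open>As \<open>j < d \<le> m\<close>, the power of s is a basis monomial, of coefficient norm
  1, and the upper left entry of its image is \<open>z ^ j\<close>.\<close>

lemma ex_large_block_image:
  fixes z :: "'p::prime_card mod_ring"
  assumes odd: "odd CARD('p)" and m: "m \<ge> 2" and z: "z \<in> mu m" "z \<notin> {1, - 1}"
  defines "d \<equiv> group.ord (units_of class_ring) z"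
  shows "\<exists>j<d. coef_norm m (RI_s [^]\<^bsub>RI m\<^esub> j :: 'p mod_ring poly \<times> 'p mod_ring poly) = 1 \<and>
    RI_s [^]\<^bsub>RI m\<^esub> j \<in> carrier (RI m) - {\<zero>\<^bsub>RI m\<^esub> :: 'p mod_ring poly \<times> 'p mod_ring poly} \<and>
    sqrt (real CARD('p) / 2) \<le> real_of_int (mat_norm (rho m z (RI_s [^]\<^bsub>RI m\<^esub> j)))"
proof -
  obtain j where j: "j < d" "sqrt (real CARD('p) / 2) \<le> real_of_int \<bar>centred (z ^ j)\<bar>"
    using ex_large_power[OF odd m z] unfolding d_def by blast
  have "j < m" using j(1) ord_mu(3)[OF _ z(1)] m unfolding d_def by simp
  then have s: "RI_s [^]\<^bsub>RI m\<^esub> j = (monom 1 j :: 'p mod_ring poly, 0)"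
    using m by (rule RI_s_pow)
  have c: "(monom 1 j :: 'p mod_ring poly, 0) \<in> carrier (RI m)"
    using \<open>j < m\<close> by (simp add: degree_monom_eq)
  have "\<bar>centred (z ^ j)\<bar> \<le> mat_norm (rho m z (monom 1 j, 0))"
    using centred_le_mat_norm_rho[OF c, of z] by (simp add: poly_monom)
  then have "sqrt (real CARD('p) / 2) \<le> real_of_int (mat_norm (rho m z (monom 1 j, 0)))"
    using j(2) by linarith
  then show ?thesis
    using j(1) c s coef_norm_monom[OF odd \<open>j < m\<close>] by (auto intro!: exI[of _ j])
qed

lemma distortion_large:
  fixes T :: "'p::prime_card mod_ring set"
  assumes odd: "odd CARD('p)" and m: "m \<ge> 2" and z: "z \<in> T" "z \<in> mu m" "z \<notin> {1, - 1}"
  shows "sqrt (real CARD('p) / 2) \<le> distortion m T"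
proof -
  obtain x :: "'p mod_ring poly \<times> 'p mod_ring poly" where x: "coef_norm m x = 1"
    "x \<in> carrier (RI m)" "x \<noteq> \<zero>\<^bsub>RI m\<^esub>"
    "sqrt (real CARD('p) / 2) \<le> real_of_int (mat_norm (rho m z x))"
    using ex_large_block_image[OF odd m z(2,3)] by blast
  then show ?thesis using distortion_ge[OF odd x(2,3) z(1)] by simp
qed

theorem mainTheorem13:
  fixes m q :: nat
  assumes "m \<ge> 2" and "even m"
    and "prime q" and "odd q" and "[q = 1] (mod m)"
    and "q = CARD('p::prime_card)"
  shows
    "(\<forall>x \<in> carrier (RI m).
        mat_norm (rho m (1 :: 'p mod_ring) x) \<le> int m * coef_norm m x)
     \<and>
     (\<forall>z \<in> mu m. z \<notin> {1, - 1 :: 'p mod_ring} \<longrightarrow>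
        (let d = group.ord (units_of class_ring) z;
             s = (RI_s :: 'p mod_ring poly \<times> 'p mod_ring poly) in
          real_of_int (Max ((\<lambda>j. \<bar>centred (z ^ j)\<bar>) ` {0..<d})) \<ge> sqrt (real q / 2) \<and>
          (\<exists>j<d. coef_norm m (s [^]\<^bsub>RI m\<^esub> j) = 1 \<and>
             real_of_int (mat_norm (rho m z (s [^]\<^bsub>RI m\<^esub> j))) \<ge> sqrt (real q / 2))))
     \<and>
     (\<forall>Z :: 'p mod_ring set. block_reps m Z \<longrightarrow>
        block_proj m Z \<in> ring_iso (RI m) (block_ring Z) \<and>
        (\<forall>I. ideal I (RI m) \<longrightarrow>
          (\<exists>T\<subseteq>Z. \<exists>\<phi> \<in> ring_iso (RI m Quot I) (block_ring T).
             \<forall>x \<in> carrier (RI m). \<phi> (I +>\<^bsub>RI m\<^esub> x) = block_proj m T x)) \<and>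
        (real m < sqrt (real q / 2) \<longrightarrow>
          rho m (1 :: 'p mod_ring) ` carrier (RI m) = carrier M2 \<and>
          distortion m {1 :: 'p mod_ring} \<le> real m \<and>
          distortion m {1 :: 'p mod_ring} < sqrt (real q / 2) \<and>
          (\<forall>T\<subseteq>Z. {1} \<subset> T \<longrightarrow> distortion m T \<ge> sqrt (real q / 2)) \<and>
          (\<forall>T\<subseteq>Z. {1} \<subseteq> T \<and> distortion m T < sqrt (real q / 2) \<longrightarrow> T = {1})))"
proof -
  have odd: "odd CARD('p)" using assms by simp
  have dvd: "m dvd CARD('p) - 1"
    using cong_to_1_nat[OF assms(5)] assms(6) by simp
  show ?thesis
  proof (intro conjI ballI allI impI)
    fix x :: "'p mod_ring poly \<times> 'p mod_ring poly"
    assume "x \<in> carrier (RI m)"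
    then show "mat_norm (rho m 1 x) \<le> int m * coef_norm m x"
      by (rule mat_norm_rho_1_le[OF odd])
  next
    fix z :: "'p mod_ring"
    assume z: "z \<in> mu m" "z \<notin> {1, - 1}"
    let ?d = "group.ord (units_of class_ring) z"
    obtain j where j: "j < ?d" "sqrt (real q / 2) \<le> real_of_int \<bar>centred (z ^ j)\<bar>"
      using ex_large_power[OF odd assms(1) z] assms(6) by blast
    have "\<bar>centred (z ^ j)\<bar> \<le> Max ((\<lambda>j. \<bar>centred (z ^ j)\<bar>) ` {0..<?d})"
      using j(1) by (intro Max_ge) auto
    then have "sqrt (real q / 2) \<le> real_of_int (Max ((\<lambda>j. \<bar>centred (z ^ j)\<bar>) ` {0..<?d}))"
      using j(2) by linarith
    then show "let d = ?d; s = (RI_s :: 'p mod_ring poly \<times> 'p mod_ring poly) in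
        real_of_int (Max ((\<lambda>j. \<bar>centred (z ^ j)\<bar>) ` {0..<d})) \<ge> sqrt (real q / 2) \<and>
        (\<exists>j<d. coef_norm m (s [^]\<^bsub>RI m\<^esub> j) = 1 \<and>
          real_of_int (mat_norm (rho m z (s [^]\<^bsub>RI m\<^esub> j))) \<ge> sqrt (real q / 2))"
      using ex_large_block_image[OF odd assms(1) z] assms(6) unfolding Let_def by blast
  next
    fix Z :: "'p mod_ring set"
    assume Z: "block_reps m Z"
    interpret block_system m Z
      using assms Z dvd by unfold_locales (auto intro: card_mu)
    show "block_proj m Z \<in> ring_iso (RI m) (block_ring Z)" by (rule block_proj_iso)
    show "\<exists>T\<subseteq>Z. \<exists>\<phi>\<in>ring_iso (RI m Quot I) (block_ring T).
        \<forall>x\<in>carrier (RI m). \<phi> (I +>\<^bsub>RI m\<^esub> x) = block_proj m T x" if "ideal I (RI m)" for I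
      using that by (rule quotient_iso_blocks)
    have one: "1 \<in> Z" using Z by (simp add: block_reps_def)
    show "rho m (1 :: 'p mod_ring) ` carrier (RI m) = carrier M2"
      by (rule rho_surj[OF one])
    show le: "distortion m {1 :: 'p mod_ring} \<le> real m"
      using assms(1) by (intro distortion_1_le[OF odd]) simp
    show "distortion m {1 :: 'p mod_ring} < sqrt (real q / 2)" if "real m < sqrt (real q / 2)"
      using le that by linarith
    have large: "sqrt (real q / 2) \<le> distortion m T" if T: "T \<subseteq> Z" "{1} \<subset> T" for T
    proof -
      \<comment> \<open>Since 1 is in \<open>Z\<close>, -1 is not; so a further block of
        \<open>T\<close> belongs to some \<open>z\<close> different from both 1 and -1.\<close>
      obtain z where z: "z \<in> T" "z \<noteq> 1" using T(2) by blast
      then have "z \<in> mu m" "z \<notin> {1, - 1}"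
        using T(1) Z_mu uminus_notin_Z[OF one] by auto
      then show ?thesis using distortion_large[OF odd assms(1) z(1)] assms(6) by simp
    qed
    show "sqrt (real q / 2) \<le> distortion m T" if "T \<subseteq> Z" "{1} \<subset> T" for T
      using that by (rule large)
    show "T = {1}" if "T \<subseteq> Z" "{1} \<subseteq> T \<and> distortion m T < sqrt (real q / 2)" for T
      using large[of T] that by force
  qed
qed

end
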